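(* Let $q=p^e$ be a prime power, $g$ a positive divisor of $q-1$, and $n$ a positive integer coprime to $q$. Write $g=g_1^{e_1}\cdots g_u^{e_u}$ and $n=g_1^{f_1}\cdots g_u^{f_u}p_1^{j_1}\cdots p_s^{j_s}$, where $g_1,\dots,g_u,p_1,\dots,p_s$ are pairwise distinct primes different from $p$, $g_1<\cdots<g_u$, $p_1<\cdots<p_s$, the $e_k$ and $j_k$ are positive integers and the $f_k$ are nonnegative integers. Put $n_1=g_1^{f_1}\cdots g_u^{f_u}$. Then the set $1+g\mathbb{Z}/ng\mathbb{Z}=\{1+kg : 0\le k\le n-1\}\subseteq\mathbb{Z}/ng\mathbb{Z}$ is the disjoint union of $q$-cyclotomic cosets modulo $ng$ $$1+g\mathbb{Z}/ng\mathbb{Z}=\bigsqcup_{\mathbf{x}\in[0,g_1^{y_1}-1]\times\cdots\times[0,g_u^{y_u}-1]}\ \bigsqcup_{I\in\mathcal{I}_{ng/n_1g}(\gamma_{\mathbf{x}})}c_{ng}(\gamma_{\mathbf{x},I}).$$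
   Context: Notation: $\mathbb{N}=\{0,1,\dots\}$; $[a,b]$ is the set of integers from $a$ to $b$; $v_\ell$ is the $\ell$-adic valuation; $\overline{[0,j_k-1]}=[0,j_k-1]\cup\{\infty\}$. The cases $u=0$ ($g=1$) and $s=0$ are allowed, with empty products equal to $1$ and empty tuples. For $M\geq1$ coprime to $q$, the $q$-cyclotomic coset modulo $M$ containing $\gamma$ is $c_M(\gamma)=\{\gamma,\gamma q,\dots,\gamma q^{\tau-1}\}\subseteq\mathbb{Z}/M\mathbb{Z}$, $\tau$ being the least positive integer with $\gamma q^\tau\equiv\gamma\pmod M$; its size is $\tau$. The exponents $y_k$ and integers $\gamma_{\mathbf{x}}$. If $g_1=2$ and $q\equiv3\pmod4$, $y_1=\max\{0,\min\{f_1-1,v_{g_1}(q+1)-e_1\}\}$; otherwise $y_1=\min\{f_1,v_{g_1}(q-1)-e_1\}$. For $2\leq k\leq u$, $y_k=\min\{f_k,v_{g_k}(q-1)-e_k\}$. For $\mathbf{x}=(x_1,\dots,x_u)$ with $x_k\in[0,g_k^{y_k}-1]$: $\gamma_{\mathbf{x}}=1+g(g_1x_1+g_1^{f_1}x_2+\cdots+g_1^{f_1}\cdots g_{u-1}^{f_{u-1}}x_u)$ if $g_1=2$ and $q\equiv3\pmod4$, and $\gamma_{\mathbf{x}}=1+g(x_1+g_1^{f_1}x_2+\cdots+g_1^{f_1}\cdots g_{u-1}^{f_{u-1}}x_u)$ otherwise. The general construction below is applied with base modulus $N_0=n_1g$, $\gamma=\gamma_{\mathbf{x}}$ and $n'=p_1^{j_1}\cdots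 p_s^{j_s}$ (so $N_0n'=ng$); $\gamma_{\mathbf{x},I}:=(\gamma_{\mathbf{x}})_I$. For $s=0$, $\mathcal{I}$ has one element $I$ and $\gamma_I=\gamma$. Let $N_0$ be a positive integer coprime to $q$ and to $p_1\cdots p_s$, $\gamma\in\mathbb{Z}$, $\tau=|c_{N_0}(\gamma)|$. For $\mathfrak{m}=(m_1,\dots,m_s)$ with $m_k\in\overline{[0,j_k-1]}$, write $\mathfrak{m}_{\leq k}=(m_1,\dots,m_k)$ and define recursively: $\bullet$ $k=1$: $r_1=[(\mathbb{Z}/p_1\mathbb{Z})^*:\langle q^\tau\rangle]$; $v_1=v_2(q^\tau+1)$ if $p_1=2$ and $q^\tau\equiv3\pmod4$, and $v_1=v_{p_1}(q^{\tau(p_1-1)/r_1}-1)$ otherwise. If $p_1=2$ and $q^\tau\equiv3\pmod 4$: $\tau_1(\mathfrak{m}_{\leq1})=\tau$ if $m_1\in\{j_1-1,\infty\}$ and $2^{\max\{1,j_1-m_1-v_1\}}\tau$ if $0\leq m_1\leq j_1-2$. Otherwise: $\tau_1(\mathfrak{m}_{\leq1})=\tau$ if $m_1=\infty$ and $p_1^{\max\{0,j_1-m_1-v_1\}}\frac{p_1-1}{r_1}\tau$ if $0\leq m_1\leq j_1-1$. $\bullet$ $2\leq k\leq s$: $r_k(\mathfrak{m}_{\leq k-1})=[(\mathbb{Z}/p_k\mathbb{Z})^*:\langle q^{\tau_{k-1}(\mathfrak{m}_{\leq k-1})}\rangle]$, $\widetilde\tau_k=\frac{\tau_{k-1}(\mathfrak{m}_{\leq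 k-1})(p_k-1)}{r_k(\mathfrak{m}_{\leq k-1})}$, $v_k(\mathfrak{m}_{\leq k-1})=v_{p_k}(q^{\widetilde\tau_k}-1)$; $\tau_k(\mathfrak{m}_{\leq k})=\tau_{k-1}(\mathfrak{m}_{\leq k-1})$ if $m_k=\infty$, and $\tau_k(\mathfrak{m}_{\leq k})=p_k^{\max\{0,j_k-m_k-v_k(\mathfrak{m}_{\leq k-1})\}}\frac{p_k-1}{r_k(\mathfrak{m}_{\leq k-1})}\tau_{k-1}(\mathfrak{m}_{\leq k-1})$ if $0\leq m_k\leq j_k-1$. Index set. $\mathcal{I}_{N_0n'/N_0}(\gamma)$ is the set of triples $(\mathfrak{m},\mathfrak{a},\mathfrak{t})$ with $\mathfrak{m}\in\overline{[0,j_1-1]}\times\cdots\times\overline{[0,j_s-1]}$ and $\mathfrak{a},\mathfrak{t}\in\mathbb{N}^s$ such that: (i) for every $k$, if $m_k=\infty$ then $a_k=t_k=0$; (ii) if $m_1\in[0,j_1-1]$: when $p_1=2$ and $q^\tau\equiv3\pmod4$, $a_1=1$ and $t_1\in[0,2^{\max\{0,\min\{v_1-1,j_1-m_1-2\}\}}-1]$; otherwise $a_1\in[1,r_1]$ and $t_1\in[0,p_1^{\min\{v_1,j_1-m_1\}-1}-1]$; (iii) for $2\leq k\leq s$, if $m_k\in[0,j_k-1]$ then $a_k\in[1,r_k(\mathfrak{m}_{\leq k-1})]$ and $t_k\in[0,p_k^{\min\{v_k(\mathfrak{m}_{\leq k-1}),j_k-m_k\}-1}-1]$. The integers $\varphi$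 and $U$. For a positive integer $B$, a prime $\ell\nmid B$, $\ell\neq p$, and $\delta\in\mathbb{Z}$, let $\varphi_B^\ell(\delta)=-\delta/B=\sum_{k\geq0}\phi_k\ell^k\in\mathbb{Z}_\ell$ ($\phi_k\in[0,\ell-1]$) and $\varphi_B^\ell(\delta)_{\leq i}=\sum_{k=0}^i\phi_k\ell^k$. Let $\theta$ be the size of $c_B(\delta)$ and $r=[(\mathbb{Z}/\ell\mathbb{Z})^*:\langle q^\theta\rangle]$. For $m\in\mathbb{N}$, $a\in[1,r]$, put $U_B^\ell(\delta;m,a)=\sum_{k=0}^{m-1}\phi_k\ell^k+u\,\ell^m$, where: if $\ell\mid q^\theta-1$ (so $r=\ell-1$), $u=\sigma^m_a$ with $[0,\ell-1]\setminus\{\phi_m\}=\{\sigma_1^m<\cdots<\sigma_{\ell-1}^m\}$; if $\ell\nmid q^\theta-1$, $u\in[0,\ell-1]$ with $u\equiv\phi_m+\sigma_a\pmod\ell$, where $\{\sigma_1<\dots<\sigma_r\}\subseteq[1,\ell-1]$ is a fixed full set of representatives of $(\mathbb{Z}/\ell\mathbb{Z})^*/\langle q^\theta\rangle$. For $\ell=2$ write $U_B^2(\delta;m)=U_B^2(\delta;m,1)=\sum_{k<m}\phi_k2^k+(1-\phi_m)2^m$. The representative $\gamma_I$. For $I=(\mathfrak{m},\mathfrak{a},\mathfrak{t})$ put $\gamma_I=\gamma_{I,s}$, where: $\bullet$ $\gamma_{I,1}=\gamma+N_0\,\varphi_{N_0}^{p_1}(\gamma)_{\leq j_1-1}$ if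 $m_1=\infty$; $\gamma_{I,1}=\gamma+N_0(U_{N_0}^2(\gamma;m_1)+2^{m_1+2}t_1)$ if $0\leq m_1\leq j_1-1$, $p_1=2$ and $q^\tau\equiv3\pmod4$; $\gamma_{I,1}=\gamma+N_0(U_{N_0}^{p_1}(\gamma;m_1,a_1)+p_1^{m_1+1}t_1)$ otherwise. $\bullet$ For $2\leq k\leq s$, with $B_k=p_1^{j_1}\cdots p_{k-1}^{j_{k-1}}N_0$: $\gamma_{I,k}=\gamma_{I,k-1}+B_k\,\varphi_{B_k}^{p_k}(\gamma_{I,k-1})_{\leq j_k-1}$ if $m_k=\infty$; $\gamma_{I,k}=\gamma_{I,k-1}+B_k\bigl(U_{B_k}^{p_k}(\gamma_{I,k-1};m_k,a_k)+p_k^{m_k+1}t_k\bigr)$ if $0\leq m_k\leq j_k-1$. (Here the size $\theta$ of $c_{B_k}(\gamma_{I,k-1})$ used in forming $U$ is $\tau_{k-1}(\mathfrak{m}_{\leq k-1})$.) *)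

theory Defs
  imports
    "HOL-Library.Extended_Nat"
    "HOL-Library.FuncSet"
    "HOL-Library.Disjoint_Sets"
    "HOL-Algebra.Generated_Groups"
    "HOL-Number_Theory.Number_Theory"
begin

(* Conventions: Z/MZ is the library's residue_ring M, with carrier {0..M-1}.
   Tuples indexed by [1,s] are extensional functions on {1..s}, so positions are 1-based. *)

section \<open>Cyclotomic cosets\<close>

definition cyclotomic_exp :: "nat \<Rightarrow> nat \<Rightarrow> int \<Rightarrow> nat" where
  "cyclotomic_exp q M \<gamma> = (LEAST t. 0 < t \<and> [\<gamma> * int q ^ t = \<gamma>] (mod int M))"

definition cyclotomic_coset :: "nat \<Rightarrow> nat \<Rightarrow> int \<Rightarrow> int set" where
  "cyclotomic_coset q M \<gamma> = {(\<gamma> * int q ^ i) mod int M | i. i < cyclotomic_exp q M \<gamma>}"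

section \<open>The quotient of (Z/lZ)* by a cyclic subgroup\<close>

abbreviation unit_group :: "nat \<Rightarrow> int monoid" where
  "unit_group l \<equiv> units_of (residue_ring (int l))"

definition power_cosets :: "nat \<Rightarrow> nat \<Rightarrow> nat \<Rightarrow> int set set" where
  "power_cosets q l \<theta> =
     rcosets\<^bsub>unit_group l\<^esub> (generate (unit_group l) {int q ^ \<theta> mod int l})"

definition power_index :: "nat \<Rightarrow> nat \<Rightarrow> nat \<Rightarrow> nat" where
  "power_index q l \<theta> = card (power_cosets q l \<theta>)"

definition full_representatives :: "nat \<Rightarrow> nat \<Rightarrow> nat \<Rightarrow> nat set \<Rightarrow> bool" where
  "full_representatives q l \<theta> S \<longleftrightarrow>
     S \<subseteq> {1..l - 1} \<and> (\<forall>C\<in>power_cosets q l \<theta>. \<exists>!x. x \<in> S \<and> int x \<in> C)"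

section \<open>Digits of rational l-adic integers\<close>

definition padic_val :: "nat \<Rightarrow> rat \<Rightarrow> int" where
  "padic_val l x =
     int (multiplicity (int l) (fst (quotient_of x))) - int (multiplicity (int l) (snd (quotient_of x)))"

definition padic_abs :: "nat \<Rightarrow> rat \<Rightarrow> real" where
  "padic_abs l x = (if x = 0 then 0 else real l powi (- padic_val l x))"

(* The expansion x = d_0 + d_1 l + d_2 l^2 + ... in Z_l. Only rational x with denominator
   prime to l occur, so convergence in the l-adic absolute value on the rationals suffices. *)
definition padic_digits :: "nat \<Rightarrow> rat \<Rightarrow> nat \<Rightarrow> nat" where
  "padic_digits l x = (THE d. (\<forall>k. d k < l) \<and>
     (\<lambda>n. padic_abs l (x - (\<Sum>k<n. of_nat (d k * l ^ k)))) \<longlonglongrightarrow> 0)"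

definition phi :: "nat \<Rightarrow> nat \<Rightarrow> int \<Rightarrow> nat \<Rightarrow> nat" where
  "phi B l \<delta> = padic_digits l (- of_int \<delta> / of_nat B)"

definition phi_le :: "nat \<Rightarrow> nat \<Rightarrow> int \<Rightarrow> nat \<Rightarrow> nat" where
  "phi_le B l \<delta> i = (\<Sum>k\<le>i. phi B l \<delta> k * l ^ k)"

section \<open>The integers U\<close>

(* The a-th smallest element of S, counting from a = 1. *)
definition nth_smallest :: "nat set \<Rightarrow> nat \<Rightarrow> nat" where
  "nth_smallest S a = sorted_list_of_set S ! (a - 1)"

(* S B l \<delta> is the fixed full set of representatives entering the second case. *)
definition U :: "nat \<Rightarrow> (nat \<Rightarrow> nat \<Rightarrow> int \<Rightarrow> nat set) \<Rightarrow> nat \<Rightarrow> nat \<Rightarrow> int \<Rightarrow> nat \<Rightarrow> nat \<Rightarrow> nat" where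
  "U q S B l \<delta> m a =
     (let \<theta> = card (cyclotomic_coset q B \<delta>);
          w = (if l dvd q ^ \<theta> - 1 then nth_smallest ({0..l - 1} - {phi B l \<delta> m}) a
               else (phi B l \<delta> m + nth_smallest (S B l \<delta>) a) mod l)
      in (\<Sum>k<m. phi B l \<delta> k * l ^ k) + w * l ^ m)"

definition representative_choice :: "nat \<Rightarrow> (nat \<Rightarrow> nat \<Rightarrow> int \<Rightarrow> nat set) \<Rightarrow> bool" where
  "representative_choice q S \<longleftrightarrow>
     (\<forall>B l \<delta>. let \<theta> = card (cyclotomic_coset q B \<delta>) in
        0 < B \<and> coprime B q \<and> prime l \<and> \<not> l dvd B \<and> \<not> l dvd q \<and> \<not> l dvd q ^ \<theta> - 1
        \<longrightarrow> full_representatives q l \<theta> (S B l \<delta>))"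

section \<open>The general construction\<close>

(* The exceptional case at position k, where t is the coset size at the previous level. *)
definition exceptional :: "nat \<Rightarrow> (nat \<Rightarrow> nat) \<Rightarrow> nat \<Rightarrow> nat \<Rightarrow> bool" where
  "exceptional q p k t \<longleftrightarrow> k = 1 \<and> p k = 2 \<and> [q ^ t = 3] (mod 4)"

definition level_val :: "nat \<Rightarrow> (nat \<Rightarrow> nat) \<Rightarrow> nat \<Rightarrow> nat \<Rightarrow> nat" where
  "level_val q p k t =
     (if exceptional q p k t then multiplicity 2 (q ^ t + 1)
      else multiplicity (p k) (q ^ (t * (p k - 1) div power_index q (p k) t) - 1))"

(* tau q p j N0 \<gamma> m k is the paper's \<tau>_k(m_1,...,m_k), extended by \<tau>_0 = \<tau>.
   Truncated subtraction is harmless inside the maxima. *)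
fun tau :: "nat \<Rightarrow> (nat \<Rightarrow> nat) \<Rightarrow> (nat \<Rightarrow> nat) \<Rightarrow> nat \<Rightarrow> int \<Rightarrow> (nat \<Rightarrow> enat) \<Rightarrow> nat \<Rightarrow> nat" where
  "tau q p j N0 \<gamma> m 0 = card (cyclotomic_coset q N0 \<gamma>)"
| "tau q p j N0 \<gamma> m (Suc i) =
     (let k = Suc i; t = tau q p j N0 \<gamma> m i; v = level_val q p k t in
      case m k of
        \<infinity> \<Rightarrow> t
      | enat mk \<Rightarrow>
          if exceptional q p k t
          then (if mk = j k - 1 then t else 2 ^ max 1 (j k - mk - v) * t)
          else p k ^ max 0 (j k - mk - v) * ((p k - 1) div power_index q (p k) t) * t)"

definition r_level :: "nat \<Rightarrow> (nat \<Rightarrow> nat) \<Rightarrow> (nat \<Rightarrow> nat) \<Rightarrow> nat \<Rightarrow> int \<Rightarrow> (nat \<Rightarrow> enat) \<Rightarrow> nat \<Rightarrow> nat" where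
  "r_level q p j N0 \<gamma> m k = power_index q (p k) (tau q p j N0 \<gamma> m (k - 1))"

definition v_level :: "nat \<Rightarrow> (nat \<Rightarrow> nat) \<Rightarrow> (nat \<Rightarrow> nat) \<Rightarrow> nat \<Rightarrow> int \<Rightarrow> (nat \<Rightarrow> enat) \<Rightarrow> nat \<Rightarrow> nat" where
  "v_level q p j N0 \<gamma> m k = level_val q p k (tau q p j N0 \<gamma> m (k - 1))"

definition index_set ::
  "nat \<Rightarrow> nat \<Rightarrow> (nat \<Rightarrow> nat) \<Rightarrow> (nat \<Rightarrow> nat) \<Rightarrow> nat \<Rightarrow> int
     \<Rightarrow> ((nat \<Rightarrow> enat) \<times> (nat \<Rightarrow> nat) \<times> (nat \<Rightarrow> nat)) set" where
  "index_set q s p j N0 \<gamma> =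
     {(m, a, t).
        m \<in> (\<Pi>\<^sub>E k\<in>{1..s}. enat ` {0..j k - 1} \<union> {\<infinity>}) \<and>
        a \<in> (\<Pi>\<^sub>E k\<in>{1..s}. UNIV) \<and>
        t \<in> (\<Pi>\<^sub>E k\<in>{1..s}. UNIV) \<and>
        (\<forall>k\<in>{1..s}.
           case m k of
             \<infinity> \<Rightarrow> a k = 0 \<and> t k = 0
           | enat mk \<Rightarrow>
               let r = r_level q p j N0 \<gamma> m k; v = v_level q p j N0 \<gamma> m k in
               if exceptional q p k (tau q p j N0 \<gamma> m (k - 1))
               then a k = 1 \<and> t k \<in> {0..2 ^ max 0 (min (v - 1) (j k - mk - 2)) - 1}
               else a k \<in> {1..r} \<and> t k \<in> {0..p k ^ (min v (j k - mk) - 1) - 1})}"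

definition level_modulus :: "(nat \<Rightarrow> nat) \<Rightarrow> (nat \<Rightarrow> nat) \<Rightarrow> nat \<Rightarrow> nat \<Rightarrow> nat" where
  "level_modulus p j N0 k = (\<Prod>i\<in>{1..<k}. p i ^ j i) * N0"

fun gamma_level ::
  "nat \<Rightarrow> (nat \<Rightarrow> nat \<Rightarrow> int \<Rightarrow> nat set) \<Rightarrow> (nat \<Rightarrow> nat) \<Rightarrow> (nat \<Rightarrow> nat) \<Rightarrow> nat \<Rightarrow> int
     \<Rightarrow> (nat \<Rightarrow> enat) \<times> (nat \<Rightarrow> nat) \<times> (nat \<Rightarrow> nat) \<Rightarrow> nat \<Rightarrow> int" where
  "gamma_level q S p j N0 \<gamma> (m, a, t) 0 = \<gamma>"
| "gamma_level q S p j N0 \<gamma> (m, a, t) (Suc i) =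
     (let k = Suc i; \<delta> = gamma_level q S p j N0 \<gamma> (m, a, t) i; B = level_modulus p j N0 k in
      \<delta> + int B *
        (case m k of
           \<infinity> \<Rightarrow> int (phi_le B (p k) \<delta> (j k - 1))
         | enat mk \<Rightarrow>
             if exceptional q p k (tau q p j N0 \<gamma> m i)
             then int (U q S B 2 \<delta> mk 1 + 2 ^ (mk + 2) * t k)
             else int (U q S B (p k) \<delta> mk (a k) + p k ^ (mk + 1) * t k)))"

section \<open>The base representatives\<close>

definition y_exp :: "nat \<Rightarrow> (nat \<Rightarrow> nat) \<Rightarrow> (nat \<Rightarrow> nat) \<Rightarrow> (nat \<Rightarrow> nat) \<Rightarrow> nat \<Rightarrow> nat" where
  "y_exp q gs es fs k =
     (if k = 1 \<and> gs 1 = 2 \<and> [q = 3] (mod 4)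
      then nat (max 0 (min (int (fs k) - 1) (int (multiplicity (gs k) (q + 1)) - int (es k))))
      else min (fs k) (multiplicity (gs k) (q - 1) - es k))"

definition gamma_base ::
  "nat \<Rightarrow> nat \<Rightarrow> nat \<Rightarrow> (nat \<Rightarrow> nat) \<Rightarrow> (nat \<Rightarrow> nat) \<Rightarrow> (nat \<Rightarrow> nat) \<Rightarrow> int" where
  "gamma_base q g u gs fs x =
     1 + int g * (\<Sum>k\<in>{1..u}.
       (if k = 1 \<and> gs 1 = 2 \<and> [q = 3] (mod 4) then int (gs 1)
        else \<Prod>i\<in>{1..<k}. int (gs i ^ fs i)) * int (x k))"

end

theory Submission
  imports Defs
begin

text \<open>
  Both unions come from trees of orbits: passing from a modulus \<open>B\<close> to \<open>B l ^ j\<close> for one prime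
  \<open>l\<close>, the residues above a fixed orbit of multiplication by \<open>q\<close> are split into orbits, and the
  parameters at that level enumerate these exactly once.

  If \<open>l\<close> does not divide \<open>B\<close> and \<open>\<theta>\<close> is the size of the orbit of \<open>\<delta>\<close> modulo \<open>B\<close>, then by the
  Chinese remainder theorem the orbits above it correspond to the orbits of \<open>Q = q ^ \<theta>\<close> on the
  residues modulo \<open>l ^ j\<close>.  The parameter \<open>m\<close> is the \<open>l\<close>-adic valuation of \<open>\<delta> + B z\<close>, read off
  from the digits of \<open>- \<delta> / B\<close>; on units \<open>a\<close> is the class modulo the subgroup generated by \<open>Q\<close>
  in the units modulo \<open>l\<close>; and \<open>t\<close> is determined modulo a power of \<open>l\<close> because \<open>Q ^ d = 1 + l ^ v c\<close>
  with \<open>l\<close> prime to \<open>c\<close> generates all residues congruent to 1 modulo \<open>l ^ v\<close>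
  (lifting the exponent; for \<open>l = 2\<close> one needs \<open>v \<ge> 2\<close>).

  If \<open>l\<close> divides \<open>g\<close>, everything in sight is a unit congruent to 1 modulo \<open>l\<close>, the orders of \<open>q\<close>
  modulo powers of different primes are coprime, and the same lifting statement applies to \<open>q\<close>.
\<close>

section \<open>Orbits of multiplication by q\<close>

text \<open>The size \<theta> of an orbit is an input to the next level:
  \<open>Q = q ^ \<theta>\<close> decides everything there. So each level must prove, besides
  existence and uniqueness of its parameters, that the recursive number \<open>tau\<close> is the
  true coset size; otherwise the induction cannot continue. At a prime \<open>l\<close> dividing
  \<open>g\<close> the old modulus already contains \<open>l ^ e\<close>, so residues cannot be
  split off by the Chinese remainder theorem. It is applied to exponents instead:
  \<open>q ^ cofactor k\<close> is 1 modulo \<open>g * cofactor k\<close>, and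
  \<open>cofactor k\<close> is prime to \<open>l\<close>. The ranges of \<open>t\<close> are counts
  of classes: in a fixed unit class modulo \<open>l ^ \<kappa>\<close>, residues modulo
  \<open>l ^ h\<close> fall into \<open>l ^ (min v h - \<kappa>)\<close> classes under
  multiplication by units that are 1 modulo \<open>l ^ v\<close>. In the exceptional case at 2 the
  relevant element is \<open>Q ^ 2\<close>; as \<open>Q - 1\<close> is twice an odd number, the
  valuation of \<open>Q ^ 2 - 1\<close> exceeds that of \<open>Q + 1\<close> by exactly 1. This
  shift, with \<kappa> = 2, produces the bounds \<open>v - 1\<close> and
  \<open>j - m - 2\<close>.\<close>

definition orbit_rel :: "nat \<Rightarrow> nat \<Rightarrow> int \<Rightarrow> int \<Rightarrow> bool" where
  "orbit_rel q M x y \<longleftrightarrow> (\<exists>i. [x * int q ^ i = y] (mod int M))"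

lemma orbit_relI: "[x * int q ^ i = y] (mod int M) \<Longrightarrow> orbit_rel q M x y"
  unfolding orbit_rel_def by blast

lemma orbit_rel_cong_refl: "[x = y] (mod int M) \<Longrightarrow> orbit_rel q M x y"
  by (rule orbit_relI[where i = 0]) simp

lemma orbit_rel_trans:
  assumes "orbit_rel q M x y" "orbit_rel q M y z"
  shows "orbit_rel q M x z"
proof -
  obtain i j where i: "[x * int q ^ i = y] (mod int M)" and j: "[y * int q ^ j = z] (mod int M)"
    using assms unfolding orbit_rel_def by blast
  have "[x * int q ^ i * int q ^ j = y * int q ^ j] (mod int M)"
    using i by (rule cong_scalar_right)
  then have "[x * int q ^ (i + j) = z] (mod int M)"
    using j by (simp add: power_add mult.assoc cong_trans)
  then show ?thesis by (rule orbit_relI)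
qed

lemma power_cong_1_exists:
  assumes "0 < M" "coprime q M"
  shows "\<exists>t>0. [int q ^ t = 1] (mod int M)"
proof -
  have "[q ^ totient M = 1] (mod M)"
    using assms by (intro euler_theorem) auto
  then have "[int q ^ totient M = 1] (mod int M)"
    using cong_int_iff[of "q ^ totient M" 1 M] by simp
  then show ?thesis using assms by (intro exI[of _ "totient M"]) auto
qed

text \<open>Since some positive power \<open>q ^ t\<close> is 1 modulo \<open>M\<close>, the inverse
  of \<open>q ^ i\<close> is again a natural power, \<open>q ^ (t * i - i)\<close>.\<close>

lemma orbit_rel_sym:
  assumes "0 < M" "coprime q M" "orbit_rel q M x y"
  shows "orbit_rel q M y x"
proof -
  obtain i where i: "[x * int q ^ i = y] (mod int M)"
    using assms unfolding orbit_rel_def by blast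
  obtain t where t: "t > 0" "[int q ^ t = 1] (mod int M)"
    using power_cong_1_exists[OF assms(1,2)] by blast
  have "[(int q ^ t) ^ i = 1 ^ i] (mod int M)" using t(2) by (rule cong_pow)
  then have "[x * (int q ^ t) ^ i = x * 1] (mod int M)"
    by (intro cong_scalar_left) simp
  moreover have "int q ^ i * int q ^ (t * i - i) = (int q ^ t) ^ i"
    using t(1) by (simp flip: power_add power_mult)
  moreover have "[x * int q ^ i * int q ^ (t * i - i) = y * int q ^ (t * i - i)] (mod int M)"
    using i by (rule cong_scalar_right)
  ultimately have "[y * int q ^ (t * i - i) = x] (mod int M)"
    by (simp add: mult.assoc) (metis cong_sym cong_trans)
  then show ?thesis by (rule orbit_relI)
qed

lemma orbit_rel_dvd: "M' dvd M \<Longrightarrow> orbit_rel q M x y \<Longrightarrow> orbit_rel q M' x y"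
  unfolding orbit_rel_def by (meson cong_dvd_modulus int_dvd_int_iff)

lemma orbit_rel_cong:
  assumes "[x = x'] (mod int M)" "[y = y'] (mod int M)"
  shows "orbit_rel q M x y \<longleftrightarrow> orbit_rel q M x' y'"
  using assms by (meson cong_sym orbit_rel_cong_refl orbit_rel_trans)

lemma orbit_rel_common:
  assumes "0 < M" "coprime q M" "orbit_rel q M x z" "orbit_rel q M y z"
  shows "orbit_rel q M x y"
  using assms orbit_rel_sym orbit_rel_trans by blast

text \<open>The orbit size is recorded as the generator of all exponents fixing \<open>x\<close>
  rather than as a least exponent. This form determines \<theta> uniquely and multiplies when
  coprime moduli are combined.\<close>

definition is_period :: "nat \<Rightarrow> nat \<Rightarrow> int \<Rightarrow> nat \<Rightarrow> bool" where
  "is_period q M x \<theta> \<longleftrightarrow> (\<forall>i. [x * int q ^ i = x] (mod int M) \<longleftrightarrow> \<theta> dvd i)"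

lemma is_period_unique: "is_period q M x \<theta> \<Longrightarrow> is_period q M x \<theta>' \<Longrightarrow> \<theta> = \<theta>'"
  unfolding is_period_def by (metis dvd_antisym dvd_refl)

context
  fixes q M :: nat and x :: int
  assumes M: "0 < M" "coprime q M"
begin

lemma cyclotomic_exp_props:
  "0 < cyclotomic_exp q M x" "[x * int q ^ cyclotomic_exp q M x = x] (mod int M)"
proof -
  obtain t where t: "t > 0" "[int q ^ t = 1] (mod int M)"
    using power_cong_1_exists[OF M] by blast
  have "0 < t \<and> [x * int q ^ t = x] (mod int M)"
    using t cong_scalar_left[OF t(2), of x] by simp
  from LeastI[of "\<lambda>t. 0 < t \<and> [x * int q ^ t = x] (mod int M)", OF this]
  show "0 < cyclotomic_exp q M x" "[x * int q ^ cyclotomic_exp q M x = x] (mod int M)"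
    unfolding cyclotomic_exp_def by auto
qed

lemma cong_power_cyclotomic_exp_mult:
  "[x * int q ^ (cyclotomic_exp q M x * i) = x] (mod int M)"
proof (induction i)
  case (Suc i)
  have "[x * int q ^ (cyclotomic_exp q M x * i) * int q ^ cyclotomic_exp q M x
         = x * int q ^ cyclotomic_exp q M x] (mod int M)"
    using Suc by (rule cong_scalar_right)
  then have "[x * int q ^ (cyclotomic_exp q M x * i) * int q ^ cyclotomic_exp q M x = x] (mod int M)"
    using cyclotomic_exp_props(2) cong_trans by blast
  then show ?case by (simp add: power_add mult_ac)
qed simp

lemma cong_power_mod_cyclotomic_exp:
  "[x * int q ^ i = x * int q ^ (i mod cyclotomic_exp q M x)] (mod int M)"
proof -
  let ?e = "cyclotomic_exp q M x"
  have "[x * int q ^ (?e * (i div ?e)) * int q ^ (i mod ?e) = x * int q ^ (i mod ?e)] (mod int M)"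
    using cong_power_cyclotomic_exp_mult by (rule cong_scalar_right)
  then show ?thesis by (simp add: mult.assoc flip: power_add)
qed

lemma is_period_cyclotomic_exp: "is_period q M x (cyclotomic_exp q M x)"
  unfolding is_period_def
proof (intro allI iffI)
  let ?e = "cyclotomic_exp q M x"
  fix i
  assume "[x * int q ^ i = x] (mod int M)"
  then have c: "[x * int q ^ (i mod ?e) = x] (mod int M)"
    using cong_power_mod_cyclotomic_exp cong_sym cong_trans by blast
  have "i mod ?e < ?e" using cyclotomic_exp_props(1) by simp
  then have "\<not> (0 < i mod ?e \<and> [x * int q ^ (i mod ?e) = x] (mod int M))"
    unfolding cyclotomic_exp_def using not_less_Least by blast
  then show "?e dvd i" using c by auto
next
  fix i
  assume "cyclotomic_exp q M x dvd i"
  then show "[x * int q ^ i = x] (mod int M)"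
    using cong_power_cyclotomic_exp_mult by (auto elim!: dvdE)
qed

lemma cyclotomic_coset_eq:
  "cyclotomic_coset q M x = {z. 0 \<le> z \<and> z < int M \<and> orbit_rel q M x z}"
proof (rule Set.set_eqI, rule iffI)
  fix z
  assume "z \<in> cyclotomic_coset q M x"
  then show "z \<in> {z. 0 \<le> z \<and> z < int M \<and> orbit_rel q M x z}"
    using M(1) by (auto simp: cyclotomic_coset_def cong_def intro!: orbit_relI)
next
  fix z
  assume "z \<in> {z. 0 \<le> z \<and> z < int M \<and> orbit_rel q M x z}"
  then obtain i where z: "0 \<le> z" "z < int M" and i: "[x * int q ^ i = z] (mod int M)"
    by (auto simp: orbit_rel_def)
  let ?i = "i mod cyclotomic_exp q M x"
  have "[x * int q ^ ?i = z] (mod int M)"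
    using i cong_power_mod_cyclotomic_exp cong_sym cong_trans by blast
  then have "z = (x * int q ^ ?i) mod int M" using z by (simp add: cong_def)
  then show "z \<in> cyclotomic_coset q M x"
    using cyclotomic_exp_props(1) by (auto simp: cyclotomic_coset_def)
qed

lemma card_cyclotomic_coset: "card (cyclotomic_coset q M x) = cyclotomic_exp q M x"
proof -
  let ?e = "cyclotomic_exp q M x"
  let ?f = "\<lambda>i. (x * int q ^ i) mod int M"
  have *: "i = j" if ij: "i \<le> j" "j < ?e" "?f i = ?f j" for i j
  proof -
    \<comment> \<open>Completing the exponent \<open>i\<close> to a full period takes the place of
      cancelling \<open>q ^ i\<close>; the other side then has exponent
      \<open>?e + (j - i)\<close>.\<close>
    have "[x * int q ^ i * int q ^ (?e - i) = x * int q ^ j * int q ^ (?e - i)] (mod int M)"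
      using ij(3) by (intro cong_scalar_right) (simp add: cong_def)
    moreover have "i + (?e - i) = ?e" "j + (?e - i) = ?e + (j - i)" using ij by auto
    ultimately have c: "[x * int q ^ ?e = x * int q ^ (?e + (j - i))] (mod int M)"
      by (metis mult.assoc power_add)
    then have "[x * int q ^ (?e + (j - i)) = x] (mod int M)"
      using cyclotomic_exp_props(2) cong_sym cong_trans by blast
    then have "?e dvd ?e + (j - i)"
      using is_period_cyclotomic_exp by (simp add: is_period_def)
    then have "?e dvd j - i" by simp
    then show "i = j" using ij by (metis dvd_imp_le diff_is_0_eq le_antisym less_imp_diff_less not_le
      neq0_conv)
  qed
  have "inj_on ?f {..<?e}"
    by (rule inj_onI) (metis * lessThan_iff nle_le)
  moreover have "cyclotomic_coset q M x = ?f ` {..<?e}"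
    by (auto simp: cyclotomic_coset_def)
  ultimately show ?thesis by (simp add: card_image)
qed

lemma is_period_card: "is_period q M x (card (cyclotomic_coset q M x))"
  using is_period_cyclotomic_exp card_cyclotomic_coset by simp

lemma card_cyclotomic_coset_pos: "0 < card (cyclotomic_coset q M x)"
  using cyclotomic_exp_props(1) card_cyclotomic_coset by simp

end

lemma is_period_imp_card:
  "0 < M \<Longrightarrow> coprime q M \<Longrightarrow> is_period q M x \<theta> \<Longrightarrow> card (cyclotomic_coset q M x) = \<theta>"
  using is_period_card is_period_unique by blast

section \<open>Orbits modulo a product of coprime moduli\<close>

lemma cong_mult_modulus_int:
  fixes a b :: int
  assumes "coprime M N"
  shows "[a = b] (mod int (M * N)) \<longleftrightarrow> [a = b] (mod int M) \<and> [a = b] (mod int N)"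
  using assms by (metis coprime_cong_mult cong_dvd_modulus coprime_int_iff dvd_triv_left
      dvd_triv_right of_nat_mult)

context
  fixes q B L \<theta> :: nat and \<delta> :: int
  assumes per: "is_period q B \<delta> \<theta>" and cop: "coprime B L"
begin

lemma is_period_cong: "[w = \<delta>] (mod int B) \<Longrightarrow> is_period q B w \<theta>"
  using per unfolding is_period_def by (meson cong_scalar_right cong_sym cong_trans)

lemma is_period_mult:
  assumes "[w = \<delta>] (mod int B)" "is_period (q ^ \<theta>) L w \<eta>"
  shows "is_period q (B * L) w (\<theta> * \<eta>)"
  unfolding is_period_def
proof
  fix i
  have "[w * int q ^ i = w] (mod int (B * L)) \<longleftrightarrow> \<theta> dvd i \<and> [w * int q ^ i = w] (mod int L)"
    using is_period_cong[OF assms(1)] by (simp add: cong_mult_modulus_int[OF cop] is_period_def del: of_nat_mult)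
  also have "\<dots> \<longleftrightarrow> (\<exists>n. i = \<theta> * n \<and> [w * int (q ^ \<theta>) ^ n = w] (mod int L))"
    by (auto simp: power_mult elim!: dvdE)
  also have "\<dots> \<longleftrightarrow> (\<exists>n. i = \<theta> * n \<and> \<eta> dvd n)"
    using assms(2) unfolding is_period_def by blast
  also have "\<dots> \<longleftrightarrow> \<theta> * \<eta> dvd i"
    by (auto simp: dvd_def mult.assoc)
  finally show "[w * int q ^ i = w] (mod int (B * L)) \<longleftrightarrow> \<theta> * \<eta> dvd i" .
qed

text \<open>Both points lie over \<delta> modulo \<open>B\<close>, so only exponents divisible by
  \<theta> can carry one to the other, and along these \<open>q\<close> acts modulo \<open>L\<close>
  as \<open>q ^ \<theta>\<close>.\<close>

lemma orbit_rel_mult_iff: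
  assumes "[w = \<delta>] (mod int B)" "[w' = \<delta>] (mod int B)"
  shows "orbit_rel q (B * L) w w' \<longleftrightarrow> orbit_rel (q ^ \<theta>) L w w'"
proof -
  have "[w * int q ^ i = w'] (mod int B) \<longleftrightarrow> \<theta> dvd i" for i
  proof -
    have "[w * int q ^ i = w'] (mod int B) \<longleftrightarrow> [w * int q ^ i = w] (mod int B)"
      using assms by (meson cong_sym cong_trans)
    then show ?thesis using is_period_cong[OF assms(1)] by (simp add: is_period_def)
  qed
  then have "orbit_rel q (B * L) w w' \<longleftrightarrow> (\<exists>i. \<theta> dvd i \<and> [w * int q ^ i = w'] (mod int L))"
    by (simp add: orbit_rel_def cong_mult_modulus_int[OF cop] del: of_nat_mult)
  also have "\<dots> \<longleftrightarrow> (\<exists>i. [w * int q ^ (\<theta> * i) = w'] (mod int L))"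
    by (metis dvdE dvd_triv_left)
  also have "\<dots> \<longleftrightarrow> orbit_rel (q ^ \<theta>) L w w'"
    by (simp add: orbit_rel_def power_mult)
  finally show ?thesis .
qed

end

section \<open>Lifting along powers of a prime\<close>

text \<open>The quadratic coefficient stays explicit because its divisibility by \<open>l\<close> is
  needed when \<open>x\<close> is divisible by an odd prime \<open>l\<close> only once; the cubic
  remainder is always small enough.\<close>

lemma one_plus_power_expand:
  fixes x :: int
  shows "\<exists>R. (1 + x) ^ n = 1 + int n * x + int (n choose 2) * x\<^sup>2 + R * x ^ 3"
proof (induction n)
  case (Suc n)
  then obtain R where R: "(1 + x) ^ n = 1 + int n * x + int (n choose 2) * x\<^sup>2 + R * x ^ 3"
    by blast
  have "Suc n choose 2 = n + (n choose 2)" by (simp add: numeral_2_eq_2)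
  then have "(1 + x) ^ Suc n = 1 + int (Suc n) * x + int (Suc n choose 2) * x\<^sup>2
      + (R + R * x + int (n choose 2)) * x ^ 3"
    by (simp add: R power2_eq_square power3_eq_cube algebra_simps)
  then show ?case by blast
qed (auto intro: exI[of _ 0])

text \<open>The linear term contributes \<open>l ^ Suc v * c\<close>, and the rest is divisible by
  \<open>l ^ (v + 2)\<close>, so the valuation rises by exactly 1. For the quadratic term this uses
  \<open>l dvd l choose 2\<close> when \<open>l\<close> is odd, and \<open>2 * v \<ge> v + 2\<close>
  when \<open>l = 2\<close>, which is where \<open>v \<ge> 2\<close> enters.\<close>

lemma exact_power_lift:
  fixes c :: int
  assumes "prime l" "1 \<le> v" "l = 2 \<Longrightarrow> 2 \<le> v" "\<not> int l dvd c"
  shows "\<exists>c'. (1 + int l ^ v * c) ^ l = 1 + int l ^ Suc v * c' \<and> \<not> int l dvd c'"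
proof -
  define x where "x = int l ^ v * c"
  obtain R where R: "(1 + x) ^ l = 1 + int l * x + int (l choose 2) * x\<^sup>2 + R * x ^ 3"
    using one_plus_power_expand by blast
  have 1: "int l ^ (v + 2) dvd int (l choose 2) * x\<^sup>2"
  proof (cases "l = 2")
    case True
    have "int l ^ (v + 2) dvd int l ^ (2 * v)" using assms(3)[OF True] by (intro le_imp_power_dvd) simp
    also have "int l ^ (2 * v) dvd x\<^sup>2" by (simp add: x_def power_mult_distrib flip: power_mult mult.commute[of 2 v])
    finally show ?thesis by simp
  next
    case False
    have "l dvd l choose 2"
      using assms(1) False prime_ge_2_nat[of l] by (intro dvd_choose_prime) auto
    moreover have "int l ^ (v + 1) dvd int l ^ (2 * v)" using assms(2) by (intro le_imp_power_dvd) simp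
    then have "int l ^ (v + 1) dvd x\<^sup>2"
      by (simp add: x_def power_mult_distrib flip: power_mult mult.commute[of 2 v])
    ultimately have "int l * int l ^ (v + 1) dvd int (l choose 2) * x\<^sup>2"
      by (intro mult_dvd_mono) auto
    then show ?thesis by simp
  qed
  have "int l ^ (v + 2) dvd int l ^ (3 * v)" using assms(2) by (intro le_imp_power_dvd) simp
  also have "int l ^ (3 * v) dvd x ^ 3" by (simp add: x_def power_mult_distrib flip: power_mult mult.commute[of 3 v])
  finally have "int l ^ (v + 2) dvd x ^ 3" .
  from dvd_add[OF 1 dvd_mult[OF this]]
  have "int l ^ (v + 2) dvd int (l choose 2) * x\<^sup>2 + R * x ^ 3" .
  then obtain K where K: "int (l choose 2) * x\<^sup>2 + R * x ^ 3 = int l ^ (v + 2) * K" by (rule dvdE)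
  have "(1 + x) ^ l = 1 + int l * x + int l ^ (v + 2) * K" using R K by simp
  also have "\<dots> = 1 + int l ^ Suc v * (c + int l * K)" by (simp add: x_def algebra_simps)
  finally have "(1 + x) ^ l = 1 + int l ^ Suc v * (c + int l * K)" .
  moreover have "\<not> int l dvd c + int l * K" using assms(4) by (simp add: dvd_add_left_iff)
  ultimately show ?thesis unfolding x_def by blast
qed

lemma exact_power_lift_iter:
  fixes c :: int
  assumes "prime l" "1 \<le> v" "l = 2 \<Longrightarrow> 2 \<le> v" "\<not> int l dvd c"
  shows "\<exists>c'. (1 + int l ^ v * c) ^ (l ^ i) = 1 + int l ^ (v + i) * c' \<and> \<not> int l dvd c'"
proof (induction i)
  case 0
  then show ?case using assms(4) by (intro exI[of _ c]) simp
next
  case (Suc i)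
  then obtain c' where c': "(1 + int l ^ v * c) ^ (l ^ i) = 1 + int l ^ (v + i) * c'" "\<not> int l dvd c'"
    by blast
  have "\<exists>c''. (1 + int l ^ (v + i) * c') ^ l = 1 + int l ^ Suc (v + i) * c'' \<and> \<not> int l dvd c''"
    using assms c'(2) by (intro exact_power_lift) (auto intro: trans_le_add1)
  then show ?case using c'(1) by (simp add: power_mult mult.commute[of l])
qed

lemma coprime_int_prime_power: "prime l \<Longrightarrow> \<not> int l dvd x \<Longrightarrow> coprime x (int l ^ n)"
  by (metis coprime_commute coprime_power_left_iff prime_imp_coprime prime_nat_int_transfer)

lemma prime_solve_linear_cong:
  fixes a :: int
  assumes "prime l" "\<not> int l dvd a"
  shows "\<exists>n::nat. [a * int n = b] (mod int l ^ k)"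
proof -
  have "coprime a (int l ^ k)" using assms by (rule coprime_int_prime_power)
  then obtain y where "[a * y = 1] (mod int l ^ k)" using coprime_iff_invertible_int by blast
  then have "[a * y * b = 1 * b] (mod int l ^ k)" by (rule cong_scalar_right)
  moreover have "[a * int (nat ((y * b) mod int l ^ k)) = a * (y * b)] (mod int l ^ k)"
    using assms(1) by (intro cong_scalar_left) (simp add: prime_gt_0_nat)
  ultimately show ?thesis by (metis cong_trans mult.assoc mult_1)
qed

text \<open>Induction on the precision \<open>h\<close>, starting at \<open>v\<close>: a solution
  modulo \<open>l ^ h\<close> is corrected by a power of \<open>P ^ (l ^ (h - v))\<close>, which is
  1 modulo \<open>l ^ h\<close> but not modulo \<open>l ^ Suc h\<close>, without disturbing what is
  already achieved.\<close>

lemma principal_unit_orbit: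
  fixes c x y :: int
  assumes l: "prime l" "1 \<le> v" "l = 2 \<Longrightarrow> 2 \<le> v \<or> h \<le> v" "\<not> int l dvd c"
    and P: "int P = 1 + int l ^ v * c"
    and x: "\<not> int l dvd x" and xy: "[x = y] (mod int l ^ min v h)"
  shows "\<exists>i. [x * int P ^ i = y] (mod int l ^ h)"
proof (cases "h \<le> v")
  case True
  then show ?thesis using xy by (intro exI[of _ 0]) (simp add: min_absorb2)
next
  case False
  then have two: "l = 2 \<Longrightarrow> 2 \<le> v" and "v \<le> h" using l(3) by auto
  from \<open>v \<le> h\<close> have "[x = y] (mod int l ^ v)" using xy by (simp add: min_def split: if_splits)
  with \<open>v \<le> h\<close> show ?thesis
  proof (induction h rule: dec_induct)
    case base
    then show ?case by (intro exI[of _ 0]) simp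
  next
    case (step h)
    then obtain i where i: "[x * int P ^ i = y] (mod int l ^ h)" by blast
    then have "int l ^ h dvd y - x * int P ^ i" by (simp add: cong_iff_dvd_diff dvd_diff_commute)
    then obtain s where s: "y - x * int P ^ i = int l ^ h * s" by (rule dvdE)
    obtain c' where c': "int P ^ (l ^ (h - v)) = 1 + int l ^ h * c'" "\<not> int l dvd c'"
      using exact_power_lift_iter[OF l(1,2) two l(4), where i = "h - v"] step(1) by (auto simp: P)
    have Pl: "\<not> int l dvd int P"
      using l(1,2) prime_gt_1_nat[of l] by (auto simp: P dvd_add_left_iff dvd_power)
    have pr: "prime (int l)" using l(1) by simp
    have "\<not> int l dvd x * int P ^ i * c'"
      using Pl x c'(2) pr by (meson prime_dvd_mult_iff prime_dvd_power)
    \<comment> \<open>The number \<open>n\<close> of correction factors is chosen so that their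
      linear term equals the remaining error \<open>s\<close> modulo \<open>l\<close>.\<close>
    then obtain n :: nat where n: "[x * int P ^ i * c' * int n = s] (mod int l ^ 1)"
      using prime_solve_linear_cong[OF l(1)] by blast
    obtain R where R: "(1 + int l ^ h * c') ^ n
        = 1 + int n * (int l ^ h * c') + int (n choose 2) * (int l ^ h * c')\<^sup>2 + R * (int l ^ h * c') ^ 3"
      using one_plus_power_expand by blast
    have "1 \<le> h" using step(1) l(2) by simp
    have d1: "int l ^ Suc h dvd int (n choose 2) * (int l ^ h * c')\<^sup>2"
    proof -
      have "int l ^ Suc h dvd int l ^ (2 * h)" using \<open>1 \<le> h\<close> by (intro le_imp_power_dvd) simp
      then show ?thesis by (simp add: power_mult_distrib dvd_mult dvd_mult2 flip: power_mult mult.commute[of 2 h])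
    qed
    have d2: "int l ^ Suc h dvd R * (int l ^ h * c') ^ 3"
    proof -
      have "int l ^ Suc h dvd int l ^ (3 * h)" using \<open>1 \<le> h\<close> by (intro le_imp_power_dvd) simp
      then show ?thesis by (simp add: power_mult_distrib dvd_mult dvd_mult2 flip: power_mult mult.commute[of 3 h])
    qed
    have "[(1 + int l ^ h * c') ^ n = 1 + int n * (int l ^ h * c')] (mod int l ^ Suc h)"
      unfolding R cong_iff_dvd_diff using dvd_add[OF d1 d2] by (simp add: add.assoc)
    then have "[x * int P ^ i * (1 + int l ^ h * c') ^ n
        = x * int P ^ i * (1 + int n * (int l ^ h * c'))] (mod int l ^ Suc h)"
      by (rule cong_scalar_left)
    also have "x * int P ^ i * (1 + int n * (int l ^ h * c'))
        = x * int P ^ i + int l ^ h * (x * int P ^ i * c' * int n)" by (simp add: algebra_simps)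
    also have "[\<dots> = x * int P ^ i + int l ^ h * s] (mod int l ^ Suc h)"
    proof -
      have "int l dvd x * int P ^ i * c' * int n - s" using n by (simp add: cong_iff_dvd_diff)
      then have "int l ^ h * int l dvd int l ^ h * (x * int P ^ i * c' * int n - s)" by (rule mult_dvd_mono[OF dvd_refl])
      then show ?thesis by (simp add: cong_iff_dvd_diff right_diff_distrib mult.commute)
    qed
    also have "x * int P ^ i + int l ^ h * s = y" using s by simp
    finally have "[x * int P ^ (i + l ^ (h - v) * n) = y] (mod int l ^ Suc h)"
      by (simp add: power_add power_mult c'(1) mult.assoc)
    then show ?case by blast
  qed
qed

lemma power_one_plus_multiple_cong:
  fixes c :: int
  shows "[(1 + m * c) ^ i = 1] (mod m)"
proof -
  have "[1 + m * c = 1] (mod m)" by (simp add: cong_iff_dvd_diff)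
  from cong_pow[OF this, of i] show ?thesis by simp
qed

text \<open>The exponent \<open>d\<close> is the order of \<open>Q\<close> modulo \<open>l ^ \<kappa>\<close>. Usually \<open>\<kappa> = 1\<close>; the choice
  \<open>\<kappa> = 2\<close> serves \<open>l = 2\<close>, \<open>Q \<equiv> 3\<close> modulo 4, where \<open>Q\<^sup>2\<close> but not \<open>Q\<close> itself satisfies \<open>v \<ge> 2\<close>;
  at primes dividing \<open>g\<close> one takes for \<open>\<kappa>\<close> their exponent in \<open>g\<close>.\<close>

locale prime_lift =
  fixes l \<kappa> d v h Q :: nat and c :: int
  assumes prime_l: "prime l"
    and kappa: "1 \<le> \<kappa>" "\<kappa> \<le> v" "\<kappa> \<le> h"
    and not_dvd_Q: "\<not> l dvd Q"
    and order_kappa: "\<And>i. [int Q ^ i = 1] (mod int l ^ \<kappa>) \<longleftrightarrow> d dvd i"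
    and Q_pow_d: "int Q ^ d = 1 + int l ^ v * c" "\<not> int l dvd c"
    and l_two: "l = 2 \<Longrightarrow> 2 \<le> v \<or> h \<le> v"
begin

lemmas coprime_power = coprime_int_prime_power[OF prime_l]

text \<open>The discrepancy \<open>w - c0\<close>, divided by \<open>l ^ \<kappa>\<close> and by the
  unit \<open>b\<close>, gives \<open>t\<close> up to precision \<open>min v h\<close>; from there
  to \<open>h\<close> the powers of \<open>Q ^ d\<close> close the gap by
  \<open>principal_unit_orbit\<close>.\<close>

lemma lift_exists:
  assumes "\<not> int l dvd b" "\<not> int l dvd w" and w: "[w = c0] (mod int l ^ \<kappa>)"
  shows "\<exists>t<l ^ (min v h - \<kappa>). \<exists>i. [w * int Q ^ (d * i) = c0 + b * int l ^ \<kappa> * int t] (mod int l ^ h)"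
proof -
  have "int l ^ \<kappa> dvd w - c0" using w by (simp add: cong_iff_dvd_diff)
  then obtain s where s: "w - c0 = int l ^ \<kappa> * s" by (rule dvdE)
  define k where "k = min v h - \<kappa>"
  obtain n :: nat where n: "[b * int n = s] (mod int l ^ k)"
    using prime_solve_linear_cong[OF prime_l assms(1)] by blast
  define t where "t = n mod l ^ k"
  have t: "t < l ^ k" using prime_l by (simp add: t_def prime_gt_0_nat)
  have "[b * int t = b * int n] (mod int l ^ k)"
    by (intro cong_scalar_left) (simp add: t_def cong_def zmod_int)
  then have "[s = b * int t] (mod int l ^ k)" using n cong_sym cong_trans by blast
  then have "int l ^ \<kappa> * int l ^ k dvd int l ^ \<kappa> * (s - b * int t)"
    unfolding cong_iff_dvd_diff by (rule mult_dvd_mono[OF dvd_refl])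
  moreover have "\<kappa> + k = min v h" using kappa by (simp add: k_def)
  ultimately have "int l ^ min v h dvd w - (c0 + b * int l ^ \<kappa> * int t)"
    using s by (simp add: algebra_simps flip: power_add)
  then have "[w = c0 + b * int l ^ \<kappa> * int t] (mod int l ^ min v h)"
    by (simp add: cong_iff_dvd_diff)
  moreover have "1 \<le> v" using kappa by simp
  ultimately have "\<exists>i. [w * int (Q ^ d) ^ i = c0 + b * int l ^ \<kappa> * int t] (mod int l ^ h)"
    using prime_l l_two Q_pow_d assms(2) by (intro principal_unit_orbit[of l v h c "Q ^ d"]) auto
  then show ?thesis using t unfolding k_def by (auto simp: power_mult)
qed

text \<open>Modulo \<open>l ^ \<kappa>\<close> both points are the unit \<open>c0\<close>, so the
  connecting exponent is a multiple of \<open>d\<close>. The connecting power is then 1 modulo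
  \<open>l ^ v\<close> and cannot move \<open>t\<close> at precision \<open>min v h\<close>.\<close>

lemma lift_unique:
  assumes "\<not> int l dvd b" "\<not> int l dvd c0" "t < l ^ (min v h - \<kappa>)" "t' < l ^ (min v h - \<kappa>)"
    and rel: "orbit_rel Q (l ^ h) (c0 + b * int l ^ \<kappa> * int t) (c0 + b * int l ^ \<kappa> * int t')"
  shows "t = t'"
proof -
  obtain i where i: "[(c0 + b * int l ^ \<kappa> * int t) * int Q ^ i = c0 + b * int l ^ \<kappa> * int t'] (mod int l ^ h)"
    using rel by (auto simp: orbit_rel_def)
  then have "[(c0 + b * int l ^ \<kappa> * int t) * int Q ^ i = c0 + b * int l ^ \<kappa> * int t'] (mod int l ^ \<kappa>)"
    using kappa(3) by (rule cong_dvd_modulus[OF _ le_imp_power_dvd])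
  moreover have m: "[c0 + b * int l ^ \<kappa> * int t = c0] (mod int l ^ \<kappa>)" for t
    by (simp add: cong_iff_dvd_diff)
  ultimately have "[c0 * int Q ^ i = c0 * 1] (mod int l ^ \<kappa>)"
    by (metis cong_scalar_right cong_sym cong_trans mult_1_right)
  then have "[int Q ^ i = 1] (mod int l ^ \<kappa>)"
    using cong_mult_lcancel coprime_power[OF assms(2)] by blast
  then obtain i' where "i = d * i'" using order_kappa by (auto elim: dvdE)
  then have "int Q ^ i = (1 + int l ^ v * c) ^ i'" by (simp add: power_mult Q_pow_d)
  then have "[int Q ^ i = 1] (mod int l ^ v)" using power_one_plus_multiple_cong by simp
  then have "[int Q ^ i = 1] (mod int l ^ min v h)"
    by (rule cong_dvd_modulus) (simp add: le_imp_power_dvd)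
  then have "[(c0 + b * int l ^ \<kappa> * int t) * int Q ^ i = (c0 + b * int l ^ \<kappa> * int t) * 1] (mod int l ^ min v h)"
    by (rule cong_scalar_left)
  moreover have "[(c0 + b * int l ^ \<kappa> * int t) * int Q ^ i = c0 + b * int l ^ \<kappa> * int t'] (mod int l ^ min v h)"
    using i by (rule cong_dvd_modulus) (simp add: le_imp_power_dvd)
  ultimately have "[c0 + b * int l ^ \<kappa> * int t = c0 + b * int l ^ \<kappa> * int t'] (mod int l ^ min v h)"
    by (metis cong_sym cong_trans mult_1_right)
  then have "int l ^ min v h dvd int l ^ \<kappa> * (b * (int t - int t'))"
    by (simp add: cong_iff_dvd_diff algebra_simps)
  moreover have "min v h = \<kappa> + (min v h - \<kappa>)" using kappa by simp
  ultimately have "int l ^ \<kappa> * int l ^ (min v h - \<kappa>) dvd int l ^ \<kappa> * (b * (int t - int t'))"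
    by (metis power_add)
  then have "int l ^ (min v h - \<kappa>) dvd b * (int t - int t')"
    using prime_l prime_gt_0_nat[of l] by (subst (asm) dvd_mult_cancel_left) auto
  then have "int l ^ (min v h - \<kappa>) dvd int t - int t'"
    using coprime_power[OF assms(1)] by (metis coprime_commute coprime_dvd_mult_right_iff)
  then have "[int t = int t'] (mod int (l ^ (min v h - \<kappa>)))" by (simp add: cong_iff_dvd_diff)
  then have "[t = t'] (mod l ^ (min v h - \<kappa>))" using cong_int_iff by blast
  then show "t = t'" using assms(3,4) by (simp add: cong_def)
qed

text \<open>The order of \<open>Q ^ d\<close> divides \<open>l ^ (h - v)\<close> and, by exactness
  of the lifted valuations, does not divide the previous power of \<open>l\<close>. For
  \<open>h \<le> v\<close> truncated subtraction makes the factor 1, as it should be.\<close>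

lemma power_cong_1_iff: "[int Q ^ i = 1] (mod int l ^ h) \<longleftrightarrow> d * l ^ (h - v) dvd i"
proof -
  have "[int Q ^ i = 1] (mod int l ^ h) \<longleftrightarrow> d dvd i \<and> [int Q ^ i = 1] (mod int l ^ h)"
    using order_kappa kappa(3) by (metis cong_dvd_modulus le_imp_power_dvd)
  also have "\<dots> \<longleftrightarrow> d dvd i \<and> d * l ^ (h - v) dvd i"
  proof (cases "d dvd i")
    case True
    then obtain n where n: "i = d * n" by (rule dvdE)
    have d0: "d \<noteq> 0"
    proof
      assume "d = 0"
      then have "int l ^ v * c = 0" using Q_pow_d by simp
      then show False using Q_pow_d(2) prime_l prime_gt_0_nat[of l] by auto
    qed
    have "[int (Q ^ d) ^ n = 1] (mod int l ^ h) \<longleftrightarrow> l ^ (h - v) dvd n"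
    proof (cases "h \<le> v")
      case True
      have "[int (Q ^ d) ^ n = 1] (mod int l ^ v)"
        using power_one_plus_multiple_cong Q_pow_d(1) by simp
      then show ?thesis using True by (simp add: cong_dvd_modulus[OF _ le_imp_power_dvd])
    next
      case False
      define e where "e = h - v - 1"
      have e: "h - v = Suc e" "v + Suc e = h" using False by (auto simp: e_def)
      have two: "l = 2 \<Longrightarrow> 2 \<le> v" and v1: "1 \<le> v" using False l_two kappa by auto
      have it: "\<exists>c'. int (Q ^ d) ^ (l ^ i) = 1 + int l ^ (v + i) * c' \<and> \<not> int l dvd c'" for i
        using exact_power_lift_iter[OF prime_l v1 two Q_pow_d(2), where i = i] Q_pow_d(1) by simp
      obtain c1 where c1: "int (Q ^ d) ^ (l ^ e) = 1 + int l ^ (v + e) * c1" "\<not> int l dvd c1"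
        using it by blast
      obtain c2 where c2: "int (Q ^ d) ^ (l ^ Suc e) = 1 + int l ^ h * c2"
        using it[of "Suc e"] unfolding e(2) by blast
      have ord: "[int (Q ^ d) ^ n = 1] (mod int l ^ h) \<longleftrightarrow> ord (l ^ h) (Q ^ d) dvd n" for n
        using ord_divides[of "Q ^ d" n "l ^ h"] cong_int_iff[of "(Q ^ d) ^ n" 1 "l ^ h"] by simp
      have "[int (Q ^ d) ^ (l ^ Suc e) = 1] (mod int l ^ h)" unfolding c2 by (simp add: cong_iff_dvd_diff)
      then have "ord (l ^ h) (Q ^ d) dvd l ^ Suc e" using ord by blast
      then obtain k where k: "k \<le> Suc e" "ord (l ^ h) (Q ^ d) = l ^ k"
        using divides_primepow_nat[OF prime_l, of _ "Suc e"] by blast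
      have "\<not> [int (Q ^ d) ^ (l ^ e) = 1] (mod int l ^ h)"
      proof
        assume "[int (Q ^ d) ^ (l ^ e) = 1] (mod int l ^ h)"
        then have "int l ^ h dvd int l ^ (v + e) * c1" unfolding c1 by (simp add: cong_iff_dvd_diff)
        then have "int l ^ (v + e) * int l dvd int l ^ (v + e) * c1"
          using e by (metis add_Suc_right power_Suc2)
        then show False using c1(2) prime_l prime_gt_0_nat[of l] by simp
      qed
      then have "\<not> l ^ k dvd l ^ e" using ord k by metis
      then have "k = Suc e" using k(1) le_imp_power_dvd by (metis le_SucE)
      then show ?thesis using ord k e by simp
    qed
    then show ?thesis using n d0 by (simp add: power_mult)
  qed auto
  also have "\<dots> \<longleftrightarrow> d * l ^ (h - v) dvd i" using dvd_mult_left by blast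
  finally show ?thesis .
qed

end

section \<open>Digits\<close>

text \<open>Bridge from the absolute value to divisibility: the reduced denominator still divides
  \<open>B\<close>, so it is prime to \<open>l\<close> and the valuation is that of the integer
  numerator \<open>z\<close>.\<close>

lemma padic_abs_integer_div:
  assumes "prime l" "0 < B" "\<not> l dvd B"
  shows "int l ^ n dvd z \<longleftrightarrow> padic_abs l (of_int z / of_nat B) \<le> real l powi (- int n)"
proof (cases "z = 0")
  case True
  then show ?thesis by (simp add: padic_abs_def power_int_def)
next
  case False
  have l1: "1 < real l" using assms(1) prime_gt_1_nat by simp
  obtain a b where ab: "quotient_of (of_int z / of_nat B) = (a, b)" by (cases "quotient_of (of_int z / of_nat B)")
  then have b: "0 < b" and eq: "(of_int z / of_nat B :: rat) = of_int a / of_int b"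
    by (simp_all add: quotient_of_denom_pos quotient_of_div)
  have cop: "coprime a b" using ab by (rule quotient_of_coprime)
  have "(of_int (z * b) :: rat) = of_int (a * int B)"
    using eq b assms(2) by (simp add: field_simps)
  then have zb: "z * b = a * int B" by (simp only: of_int_eq_iff)
  then have "b dvd int B" using cop by (metis coprime_commute coprime_dvd_mult_right_iff dvd_triv_right)
  then have lb: "\<not> int l dvd b" using assms(3) by (meson dvd_trans int_dvd_int_iff)
  have a0: "a \<noteq> 0" using zb b False by auto
  have pr: "prime_elem (int l)" using assms(1) by simp
  have "multiplicity (int l) (z * b) = multiplicity (int l) (a * int B)" using zb by simp
  then have mz: "multiplicity (int l) z = multiplicity (int l) a"
    using a0 b False assms lb pr
    by (simp add: prime_elem_multiplicity_mult_distrib not_dvd_imp_multiplicity_0)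
  have val: "padic_val l (of_int z / of_nat B) = int (multiplicity (int l) z)"
    using lb by (simp add: padic_val_def ab mz not_dvd_imp_multiplicity_0)
  have "int l ^ n dvd z \<longleftrightarrow> n \<le> multiplicity (int l) z"
    using False assms(1) prime_gt_1_nat[of l] by (intro power_dvd_iff_le_multiplicity) auto
  also have "\<dots> \<longleftrightarrow> real l powi (- int (multiplicity (int l) z)) \<le> real l powi (- int n)"
    using l1 by (simp add: power_int_minus power_increasing_iff)
  also have "\<dots> \<longleftrightarrow> padic_abs l (of_int z / of_nat B) \<le> real l powi (- int n)"
    using False assms(2) val by (simp add: padic_abs_def)
  finally show ?thesis .
qed

lemma digit_sum_less: "(\<And>k. d k < l) \<Longrightarrow> (\<Sum>k<n. d k * l ^ k) < (l::nat) ^ n"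
proof (induction n)
  case (Suc n)
  have "(\<Sum>k<Suc n. d k * l ^ k) < l ^ n + d n * l ^ n" using Suc by simp
  also have "\<dots> = (d n + 1) * l ^ n" by simp
  also have "\<dots> \<le> l * l ^ n" using Suc(2)[of n] by (intro mult_right_mono) auto
  finally show ?case by simp
qed simp

lemma digit_sum_add:
  "n \<le> N \<Longrightarrow> l ^ n dvd (\<Sum>k<N. d k * l ^ k) - (\<Sum>k<n. d k * l ^ k :: nat)"
proof -
  assume "n \<le> N"
  then have "{..<N} = {..<n} \<union> {n..<N}" by auto
  then have "(\<Sum>k<N. d k * l ^ k) = (\<Sum>k<n. d k * l ^ k) + (\<Sum>k\<in>{n..<N}. d k * l ^ k)"
    by (simp add: sum.union_disjoint ivl_disj_int)
  moreover have "l ^ n dvd (\<Sum>k\<in>{n..<N}. d k * l ^ k)"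
    by (intro dvd_sum dvd_mult le_imp_power_dvd) simp
  ultimately show ?thesis by simp
qed

lemma padic_digits_unique:
  assumes "prime l" "0 < B" "\<not> l dvd B"
    and d: "\<And>k. d k < l" "\<And>k. d' k < l"
    and "\<And>n. int l ^ n dvd \<delta> + int B * int (\<Sum>k<n. d k * l ^ k)"
    and "\<And>n. int l ^ n dvd \<delta> + int B * int (\<Sum>k<n. d' k * l ^ k)"
  shows "d = d'"
proof -
  have eq: "(\<Sum>k<n. d k * l ^ k) = (\<Sum>k<n. d' k * l ^ k)" for n
  proof -
    have "int l ^ n dvd (\<delta> + int B * int (\<Sum>k<n. d k * l ^ k)) - (\<delta> + int B * int (\<Sum>k<n. d' k * l ^ k))"
      using assms(6,7) by (rule dvd_diff)
    then have "int l ^ n dvd int B * (int (\<Sum>k<n. d k * l ^ k) - int (\<Sum>k<n. d' k * l ^ k))"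
      by (simp add: right_diff_distrib)
    moreover have "coprime (int l ^ n) (int B)"
      using assms(1,3) by (metis coprime_int_iff coprime_power_left_iff of_nat_power prime_imp_coprime)
    ultimately have "int l ^ n dvd int (\<Sum>k<n. d k * l ^ k) - int (\<Sum>k<n. d' k * l ^ k)"
      using coprime_dvd_mult_right_iff by blast
    then have "[int (\<Sum>k<n. d k * l ^ k) = int (\<Sum>k<n. d' k * l ^ k)] (mod int (l ^ n))"
      by (simp add: cong_iff_dvd_diff)
    then have "[(\<Sum>k<n. d k * l ^ k) = (\<Sum>k<n. d' k * l ^ k)] (mod l ^ n)"
      using cong_int_iff by blast
    then show ?thesis
      using digit_sum_less[of d l n] digit_sum_less[of d' l n] d by (simp add: cong_def)
  qed
  show "d = d'"
  proof
    fix k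
    have "(\<Sum>k<Suc k. d k * l ^ k) = (\<Sum>k<Suc k. d' k * l ^ k)" by (rule eq)
    then have "d k * l ^ k = d' k * l ^ k" using eq[of k] by simp
    then show "d k = d' k" using assms(1) prime_gt_0_nat by simp
  qed
qed

lemma padic_digits_exist:
  assumes "prime l" "\<not> l dvd B"
  shows "\<exists>d. (\<forall>k. d k < l) \<and> (\<forall>n. int l ^ n dvd \<delta> + int B * int (\<Sum>k<n. d k * l ^ k))"
proof -
  have B: "\<not> int l dvd int B" using assms(2) by simp
  have step: "\<exists>u<l. int l dvd z + int B * int u" for z
  proof -
    obtain n :: nat where n: "[int B * int n = - z] (mod int l ^ 1)"
      using prime_solve_linear_cong[OF assms(1) B] by blast
    have "[int B * int (n mod l) = int B * int n] (mod int l)"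
      by (intro cong_scalar_left) (simp add: cong_def zmod_int)
    then have "[int B * int (n mod l) = - z] (mod int l)" using n by (simp add: cong_trans)
    then have "int l dvd z + int B * int (n mod l)" by (simp add: cong_iff_dvd_diff add.commute)
    moreover have "n mod l < l" using assms(1) prime_gt_0_nat by simp
    ultimately show ?thesis by blast
  qed
  define dig where "dig z = (SOME u. u < l \<and> int l dvd z + int B * int u)" for z
  have dig: "dig z < l" "int l dvd z + int B * int (dig z)" for z
    using someI_ex[OF step[of z, unfolded]] by (auto simp: dig_def)
  \<comment> \<open>Long division: \<open>st n\<close> is the quotient of \<delta> plus
    \<open>B\<close> times the first \<open>n\<close> digits by \<open>l ^ n\<close>, and its
    residue modulo \<open>l\<close> dictates the next digit.\<close>
  define st where "st = rec_nat \<delta> (\<lambda>_ z. (z + int B * int (dig z)) div int l)"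
  have st: "st 0 = \<delta>" "st (Suc n) = (st n + int B * int (dig (st n))) div int l" for n
    by (simp_all add: st_def)
  have "\<delta> + int B * int (\<Sum>k<n. dig (st k) * l ^ k) = int l ^ n * st n" for n
  proof (induction n)
    case (Suc n)
    have "\<delta> + int B * int (\<Sum>k<Suc n. dig (st k) * l ^ k) = int l ^ n * (st n + int B * int (dig (st n)))"
      using Suc by (simp add: algebra_simps)
    also have "\<dots> = int l ^ n * (int l * st (Suc n))" using dig(2)[of "st n"] by (simp add: st)
    finally show ?case by (simp add: mult_ac)
  qed (simp add: st)
  then show ?thesis using dig(1) by (intro exI[of _ "\<lambda>k. dig (st k)"]) simp
qed

text \<open>Convergence of the digit sums is shown to be equivalent to divisibility at every
  truncation, a condition satisfied by exactly one digit sequence; hence the definite description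
  defining \<open>padic_digits\<close> is well defined.\<close>

lemma phi_props:
  assumes "prime l" "0 < B" "\<not> l dvd B"
  shows "phi B l \<delta> k < l" "int l ^ n dvd \<delta> + int B * int (\<Sum>k<n. phi B l \<delta> k * l ^ k)"
proof -
  let ?x = "- of_int \<delta> / of_nat B :: rat"
  have l1: "1 < real l" using assms(1) prime_gt_1_nat by simp
  have iff: "(\<lambda>n. padic_abs l (?x - (\<Sum>k<n. of_nat (d k * l ^ k)))) \<longlonglongrightarrow> 0 \<longleftrightarrow>
      (\<forall>n. int l ^ n dvd \<delta> + int B * int (\<Sum>k<n. d k * l ^ k))" (is "?L \<longleftrightarrow> ?R") for d
  proof -
    have eq: "?x - (\<Sum>k<n. of_nat (d k * l ^ k)) =
        of_int (- (\<delta> + int B * int (\<Sum>k<n. d k * l ^ k))) / of_nat B" for n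
      using assms(2) by (simp add: field_simps)
    have iff': "padic_abs l (?x - (\<Sum>k<n. of_nat (d k * l ^ k))) \<le> real l powi (- int i) \<longleftrightarrow>
        int l ^ i dvd \<delta> + int B * int (\<Sum>k<n. d k * l ^ k)" for n i
      using padic_abs_integer_div[OF assms, of i "- (\<delta> + int B * int (\<Sum>k<n. d k * l ^ k))"]
      unfolding eq dvd_minus_iff by blast
    show ?thesis
    proof
      assume lim: ?L
      show ?R
      proof
        fix n
        have "0 < real l powi (- int n)" using l1 by simp
        from order_tendstoD(2)[OF lim this]
        obtain N where "\<And>i. N \<le> i \<Longrightarrow>
            padic_abs l (?x - (\<Sum>k<i. of_nat (d k * l ^ k))) < real l powi (- int n)"
          unfolding eventually_sequentially by blast
        \<comment> \<open>The limit controls only late truncations. One of length at least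
          \<open>n\<close> differs from the truncation of length \<open>n\<close> by a multiple of
          \<open>l ^ n\<close>, so divisibility passes down.\<close>
        then have "padic_abs l (?x - (\<Sum>k<max N n. of_nat (d k * l ^ k))) \<le> real l powi (- int n)"
          by (meson less_imp_le max.cobounded1)
        then have "int l ^ n dvd \<delta> + int B * int (\<Sum>k<max N n. d k * l ^ k)" using iff' by blast
        moreover have "(\<Sum>k<n. d k * l ^ k) \<le> (\<Sum>k<max N n. d k * l ^ k)"
          by (intro sum_mono2) auto
        then have "int l ^ n dvd int (\<Sum>k<max N n. d k * l ^ k) - int (\<Sum>k<n. d k * l ^ k)"
          using digit_sum_add[of n "max N n" l d]
          by (metis int_dvd_int_iff max.cobounded2 of_nat_diff of_nat_power)
        then have "int l ^ n dvd int B * (int (\<Sum>k<max N n. d k * l ^ k) - int (\<Sum>k<n. d k * l ^ k))"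
          by (rule dvd_mult)
        ultimately have "int l ^ n dvd (\<delta> + int B * int (\<Sum>k<max N n. d k * l ^ k))
            - int B * (int (\<Sum>k<max N n. d k * l ^ k) - int (\<Sum>k<n. d k * l ^ k))"
          by (rule dvd_diff)
        then show "int l ^ n dvd \<delta> + int B * int (\<Sum>k<n. d k * l ^ k)"
          by (simp add: right_diff_distrib)
      qed
    next
      assume ?R
      then have le: "padic_abs l (?x - (\<Sum>k<n. of_nat (d k * l ^ k))) \<le> (1 / real l) ^ n" for n
        using iff'[of n n] by (simp add: power_int_minus power_one_over inverse_eq_divide)
      have "0 \<le> padic_abs l y" for y by (simp add: padic_abs_def)
      then show ?L
        using l1 le by (intro tendsto_sandwich[OF _ _ tendsto_const LIMSEQ_realpow_zero[of "1 / real l"]])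
          (auto intro!: always_eventually)
    qed
  qed
  define spec where "spec d \<longleftrightarrow> (\<forall>k. d k < l) \<and>
      (\<lambda>n. padic_abs l (?x - (\<Sum>k<n. of_nat (d k * l ^ k)))) \<longlonglongrightarrow> 0" for d
  obtain d where d: "\<forall>k. d k < l" "\<forall>n. int l ^ n dvd \<delta> + int B * int (\<Sum>k<n. d k * l ^ k)"
    using padic_digits_exist[OF assms(1,3)] by blast
  have "spec d" using d iff by (simp add: spec_def)
  moreover have "d' = d" if "spec d'" for d'
  proof (rule padic_digits_unique[OF assms])
    show "d' k < l" "d k < l" for k using that d by (simp_all add: spec_def)
    show "int l ^ n dvd \<delta> + int B * int (\<Sum>k<n. d' k * l ^ k)"
      "int l ^ n dvd \<delta> + int B * int (\<Sum>k<n. d k * l ^ k)" for n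
      using that d unfolding spec_def iff by blast+
  qed
  ultimately have "(THE d. spec d) = d" by (rule the_equality)
  then have "phi B l \<delta> = d" by (simp add: phi_def padic_digits_def spec_def)
  then show "phi B l \<delta> k < l" "int l ^ n dvd \<delta> + int B * int (\<Sum>k<n. phi B l \<delta> k * l ^ k)"
    using d by auto
qed

section \<open>Cosets of cyclic groups of residues\<close>

lemma cong_ord_iff: "[int q ^ i = 1] (mod int l) \<longleftrightarrow> ord l q dvd i"
  using ord_divides[of q i l] cong_int_iff[of "q ^ i" 1 l] by simp

context
  fixes q l \<theta> :: nat
  assumes l: "prime l" and lq: "\<not> l dvd q"
begin

interpretation residues_prime l "residue_ring (int l)"
  using l by unfold_locales

lemma carrier_unit_group: "carrier (unit_group l) = {1..int l - 1}"
proof -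
  have "int (l - 1) = int l - 1" using prime_gt_0_nat[OF l] by linarith
  then show ?thesis by (simp add: units_of_carrier res_prime_units_eq)
qed

lemma power_in_unit_group: "int q ^ i mod int l \<in> carrier (unit_group l)"
proof -
  have "\<not> int l dvd int q ^ i"
    using l lq by (metis int_dvd_int_iff of_nat_power prime_dvd_power)
  then have "int q ^ i mod int l \<noteq> 0" by (simp add: dvd_eq_mod_eq_0)
  moreover have "0 \<le> int q ^ i mod int l" "int q ^ i mod int l < int l"
    using l prime_gt_0_nat by simp_all
  ultimately show ?thesis by (simp add: carrier_unit_group)
qed

interpretation G: group "unit_group l"
  by (rule units_group)

lemma mult_unit_group: "x \<otimes>\<^bsub>unit_group l\<^esub> y = (x * y) mod int l"
  by (simp add: units_of_mult res_mult_eq)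

lemma nat_pow_unit_group:
  "(int q ^ \<theta> mod int l) [^]\<^bsub>unit_group l\<^esub> (i::nat) = int (q ^ \<theta>) ^ i mod int l"
proof (induction i)
  case 0
  then show ?case using prime_gt_1_nat[OF l] by (simp add: units_of_one res_one_eq)
next
  case (Suc i)
  then show ?case by (simp add: mult_unit_group mod_mult_eq mult.commute)
qed

definition power_subgroup where "power_subgroup = generate (unit_group l) {int q ^ \<theta> mod int l}"

lemma power_subgroup_eq: "power_subgroup = {int (q ^ \<theta>) ^ i mod int l | i. True}"
proof -
  have fin: "finite (carrier (unit_group l))" by (simp add: carrier_unit_group)
  show ?thesis
    unfolding power_subgroup_def G.generate_pow_on_finite_carrier[OF fin power_in_unit_group]
    by (simp add: nat_pow_unit_group)
qed

lemma subgroup_power_subgroup: "subgroup power_subgroup (unit_group l)"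
  unfolding power_subgroup_def using power_in_unit_group by (intro G.generate_is_subgroup) simp

lemma power_cosets_eq: "power_cosets q l \<theta> = rcosets\<^bsub>unit_group l\<^esub> power_subgroup"
  by (simp add: power_cosets_def power_subgroup_def)

lemma card_power_subgroup: "card power_subgroup = ord l (q ^ \<theta>)"
proof -
  let ?Q = "q ^ \<theta>" and ?f = "\<lambda>i. int (q ^ \<theta>) ^ i mod int l"
  have cop: "coprime l ?Q" using l lq by (simp add: prime_imp_coprime)
  have eq: "?f i = ?f j \<longleftrightarrow> [i = j] (mod ord l ?Q)" for i j
    using order_divides_expdiff[OF cop, of i j] cong_int_iff[of "?Q ^ i" "?Q ^ j" l]
    by (simp add: cong_def)
  have "inj_on ?f {..<ord l ?Q}" by (rule inj_onI) (simp add: eq cong_def del: of_nat_power)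
  moreover have "power_subgroup = ?f ` {..<ord l ?Q}"
  proof -
    have "?f i \<in> ?f ` {..<ord l ?Q}" for i
    proof (rule image_eqI)
      show "?f i = ?f (i mod ord l ?Q)" unfolding eq by (simp add: cong_def)
      show "i mod ord l ?Q \<in> {..<ord l ?Q}" using cop by simp
    qed
    then show ?thesis unfolding power_subgroup_eq by blast
  qed
  ultimately show ?thesis by (simp add: card_image)
qed

text \<open>Lagrange's theorem in the unit group. It identifies the quotient of \<open>l - 1\<close>
  by the index, which appears in the valuations and in the coset sizes, with the order of
  \<open>q ^ \<theta>\<close> modulo \<open>l\<close>.\<close>

lemma power_index_mult_ord: "power_index q l \<theta> * ord l (q ^ \<theta>) = l - 1"
proof -
  have "order (unit_group l) = l - 1"
    by (simp add: order_def carrier_unit_group)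
  then show ?thesis
    using G.lagrange[OF subgroup_power_subgroup] by (simp add: power_index_def power_cosets_eq card_power_subgroup)
qed

lemma mem_coset_iff:
  assumes "0 \<le> \<sigma>" "\<sigma> < int l"
  shows "\<sigma> \<in> power_subgroup #>\<^bsub>unit_group l\<^esub> (w mod int l) \<longleftrightarrow> orbit_rel (q ^ \<theta>) l w \<sigma>"
proof -
  have "\<sigma> \<in> power_subgroup #>\<^bsub>unit_group l\<^esub> (w mod int l) \<longleftrightarrow>
      (\<exists>i. \<sigma> = ((int (q ^ \<theta>) ^ i mod int l) * (w mod int l)) mod int l)"
    by (auto simp: r_coset_def power_subgroup_eq mult_unit_group)
  also have "\<dots> \<longleftrightarrow> (\<exists>i. [w * int (q ^ \<theta>) ^ i = \<sigma>] (mod int l))"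
    using assms by (auto simp: mod_mult_eq cong_def mult.commute)
  finally show ?thesis by (simp add: orbit_rel_def)
qed

lemma not_dvd_mod_unit: "\<not> int l dvd w \<Longrightarrow> w mod int l \<in> carrier (unit_group l)"
proof -
  assume "\<not> int l dvd w"
  then have "w mod int l \<noteq> 0" by (simp add: dvd_eq_mod_eq_0)
  moreover have "0 \<le> w mod int l" "w mod int l < int l"
    using l prime_gt_0_nat by simp_all
  ultimately show ?thesis by (simp add: carrier_unit_group)
qed

context
  fixes S :: "nat set"
  assumes S: "full_representatives q l \<theta> S"
begin

lemma full_representatives_bounds: "\<sigma> \<in> S \<Longrightarrow> 1 \<le> \<sigma> \<and> \<sigma> < l"
  using S prime_gt_0_nat[OF l] by (fastforce simp: full_representatives_def)

lemma full_representatives_unique: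
  assumes "\<not> int l dvd w"
  shows "\<exists>!\<sigma>. \<sigma> \<in> S \<and> orbit_rel (q ^ \<theta>) l w (int \<sigma>)"
proof -
  have "power_subgroup #>\<^bsub>unit_group l\<^esub> (w mod int l) \<in> power_cosets q l \<theta>"
    unfolding power_cosets_eq
    using not_dvd_mod_unit[OF assms] subgroup.subset[OF subgroup_power_subgroup] by (intro G.rcosetsI)
  then have "\<exists>!\<sigma>. \<sigma> \<in> S \<and> int \<sigma> \<in> power_subgroup #>\<^bsub>unit_group l\<^esub> (w mod int l)"
    using S unfolding full_representatives_def by blast
  moreover have "\<sigma> \<in> S \<and> int \<sigma> \<in> power_subgroup #>\<^bsub>unit_group l\<^esub> (w mod int l) \<longleftrightarrow>
      \<sigma> \<in> S \<and> orbit_rel (q ^ \<theta>) l w (int \<sigma>)" for \<sigma>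
    using mem_coset_iff[of "int \<sigma>" w] full_representatives_bounds[of \<sigma>] by auto
  ultimately show ?thesis by simp
qed

text \<open>Sending a representative to its coset is a bijection. This is what makes
  \<open>{1..r}\<close> the right range for the position \<open>a\<close> in the sorted list of
  representatives.\<close>

lemma card_full_representatives: "card S = power_index q l \<theta>"
proof -
  let ?f = "\<lambda>\<sigma>. power_subgroup #>\<^bsub>unit_group l\<^esub> int \<sigma>"
  have S_carrier: "int \<sigma> \<in> carrier (unit_group l)" if "\<sigma> \<in> S" for \<sigma>
    using full_representatives_bounds[OF that] by (auto simp: carrier_unit_group)
  have self: "int \<sigma> \<in> ?f \<sigma>" "?f \<sigma> \<in> power_cosets q l \<theta>" if "\<sigma> \<in> S" for \<sigma>
    using that S_carrier subgroup_power_subgroup subgroup.subset[OF subgroup_power_subgroup]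
    by (auto simp: power_cosets_eq intro!: G.rcos_self G.rcosetsI)
  have "inj_on ?f S"
  proof (rule inj_onI)
    fix x y assume "x \<in> S" "y \<in> S" "?f x = ?f y"
    then show "x = y" using self S unfolding full_representatives_def by metis
  qed
  moreover have "?f ` S = power_cosets q l \<theta>"
  proof
    show "?f ` S \<subseteq> power_cosets q l \<theta>" using self by blast
    show "power_cosets q l \<theta> \<subseteq> ?f ` S"
    proof
      fix C assume C: "C \<in> power_cosets q l \<theta>"
      then obtain \<sigma> where \<sigma>: "\<sigma> \<in> S" "int \<sigma> \<in> C" using S unfolding full_representatives_def by blast
      obtain x where x: "x \<in> carrier (unit_group l)" "C = power_subgroup #>\<^bsub>unit_group l\<^esub> x"
        using C by (auto simp: power_cosets_eq RCOSETS_def)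
      then have "C = ?f \<sigma>" using G.repr_independence \<sigma> subgroup_power_subgroup by metis
      then show "C \<in> ?f ` S" using \<sigma> by blast
    qed
  qed
  ultimately show ?thesis by (metis card_image power_index_def)
qed

end

end

section \<open>One prime of the general construction\<close>

lemma cong_scale_prime_power:
  fixes x y :: int
  assumes "0 < l" "m \<le> j"
  shows "[int l ^ m * x = int l ^ m * y] (mod int (l ^ j)) \<longleftrightarrow> [x = y] (mod int (l ^ (j - m)))"
proof -
  have "int (l ^ j) = int l ^ m * int (l ^ (j - m))" using assms(2) by (simp flip: power_add)
  then show ?thesis using assms(1) by (simp add: cong_iff_dvd_diff flip: right_diff_distrib)
qed

lemma orbit_rel_scale_prime_power:
  "0 < l \<Longrightarrow> m \<le> j \<Longrightarrow>
    orbit_rel Q (l ^ j) (int l ^ m * x) (int l ^ m * y) \<longleftrightarrow> orbit_rel Q (l ^ (j - m)) x y"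
  by (simp add: orbit_rel_def mult.assoc cong_scale_prime_power del: of_nat_power)

lemma orbit_rel_cmult:
  assumes "coprime b (int M)"
  shows "orbit_rel Q M (b * x) (b * y) \<longleftrightarrow> orbit_rel Q M x y"
  by (simp add: orbit_rel_def mult.assoc cong_mult_lcancel[OF assms])

lemma bij_betw_ex1:
  assumes "bij_betw f A B" "\<exists>!u. u \<in> B \<and> P u"
  shows "\<exists>!a. a \<in> A \<and> P (f a)"
  using assms unfolding bij_betw_def inj_on_def by (metis (no_types, lifting) imageE imageI)

lemma bij_betw_nth_smallest:
  assumes "finite A"
  shows "bij_betw (nth_smallest A) {1..card A} A"
proof -
  have "bij_betw ((!) (sorted_list_of_set A)) {..<card A} A"
    using assms by (intro bij_betw_nth) (auto simp: lessThan_atLeast0)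
  moreover have "bij_betw (\<lambda>a. a - 1) {1..card A} {..<card A}"
    by (rule bij_betwI[where g = Suc]) auto
  ultimately have "bij_betw ((!) (sorted_list_of_set A) \<circ> (\<lambda>a. a - 1)) {1..card A} A"
    by (rule bij_betw_trans[rotated])
  then show ?thesis by (simp add: comp_def nth_smallest_def[abs_def])
qed

section \<open>Lifting at 2 for a multiplier congruent to 3 modulo 4\<close>

lemma prime_lift_two:
  assumes n: "Q = 4 * n + 3" and "2 \<le> h"
  shows "\<exists>c. prime_lift 2 2 2 (multiplicity 2 (Q + 1) + 1) h Q c"
proof -
  define v where "v = multiplicity 2 (Q + 1)"
  have "Q + 1 \<noteq> 0" "\<not> is_unit (2::nat)" by simp_all
  from multiplicity_decompose'[OF this] obtain c where c: "Q + 1 = 2 ^ v * c" "\<not> 2 dvd c"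
    unfolding v_def by metis
  have "(2::nat) ^ 2 dvd Q + 1" using n by simp
  then have v2: "2 \<le> v" unfolding v_def by (intro multiplicity_geI) auto
  \<comment> \<open>In \<open>Q ^ 2 - 1 = (Q + 1) * (Q - 1)\<close> the second factor supplies
    exactly one 2, hence the exponent \<open>v + 1\<close>.\<close>
  have "int Q - 1 = 2 * (2 * int n + 1)" by (simp add: n)
  moreover have "int Q + 1 = 2 ^ v * int c" using c(1) by (metis of_nat_1 of_nat_add of_nat_mult of_nat_numeral of_nat_power)
  moreover have "int Q ^ 2 = 1 + (int Q + 1) * (int Q - 1)" by (simp add: power2_eq_square algebra_simps)
  ultimately have "int Q ^ 2 = 1 + int 2 ^ (v + 1) * (int c * (2 * int n + 1))"
    by simp
  moreover have "\<not> int 2 dvd int c * (2 * int n + 1)" using c(2) by simp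
  moreover have "[int Q ^ i = 1] (mod int 2 ^ 2) \<longleftrightarrow> 2 dvd i" for i
  proof -
    have "[int Q = -1] (mod 4)" by (simp add: n cong_iff_dvd_diff)
    then have c: "[int Q ^ i = (-1) ^ i] (mod 4)" by (rule cong_pow)
    have "[(-1) ^ i = (1::int)] (mod 4) \<longleftrightarrow> 2 dvd i"
      by (cases "even i") (simp_all add: cong_iff_dvd_diff)
    then show ?thesis using c by (simp, meson cong_sym cong_trans)
  qed
  ultimately have "prime_lift 2 2 2 (v + 1) h Q (int c * (2 * int n + 1))"
    using v2 assms(2) by unfold_locales (simp_all add: n)
  then show ?thesis unfolding v_def by blast
qed

text \<open>Here \<open>Q\<close> is -1 modulo 4, so the powers of \<open>Q\<close> already act
  transitively on the odd residues modulo 4. This leaves a single class \<open>a = 1\<close> and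
  lets \<open>t\<close> start only at the digit two places above \<open>m\<close>.\<close>

lemma odd_orbit_mod_4:
  fixes w b :: int
  assumes n: "Q = 4 * n + 3" and "odd w" "odd b"
  shows "\<exists>i. [w * int Q ^ i = b] (mod int 2 ^ 2)"
proof (cases "[w = b] (mod 4)")
  case True
  then show ?thesis by (intro exI[of _ 0]) simp
next
  case False
  then have "4 dvd w * 3 - b" using assms unfolding cong_iff_dvd_diff by presburger
  moreover have "w * int Q ^ 1 - b = (w * 3 - b) + 4 * (w * int n)"
    by (simp add: n algebra_simps)
  ultimately have "4 dvd w * int Q ^ 1 - b" by (metis dvd_add dvd_triv_left)
  then show ?thesis by (intro exI[of _ 1]) (simp add: cong_iff_dvd_diff)
qed

section \<open>One level of the construction, with the previous orbit size as a parameter\<close>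

definition level_choices ::
  "nat \<Rightarrow> (nat \<Rightarrow> nat) \<Rightarrow> (nat \<Rightarrow> nat) \<Rightarrow> nat \<Rightarrow> nat \<Rightarrow> (enat \<times> nat \<times> nat) set" where
  "level_choices q p j k \<theta> = {(m, a, t). m \<in> enat ` {0..j k - 1} \<union> {\<infinity>} \<and>
     (case m of
        \<infinity> \<Rightarrow> a = 0 \<and> t = 0
      | enat mk \<Rightarrow>
          let r = power_index q (p k) \<theta>; v = level_val q p k \<theta> in
          if exceptional q p k \<theta>
          then a = 1 \<and> t \<in> {0..2 ^ max 0 (min (v - 1) (j k - mk - 2)) - 1}
          else a \<in> {1..r} \<and> t \<in> {0..p k ^ (min v (j k - mk) - 1) - 1})}"

definition level_shift ::
  "nat \<Rightarrow> (nat \<Rightarrow> nat \<Rightarrow> int \<Rightarrow> nat set) \<Rightarrow> (nat \<Rightarrow> nat) \<Rightarrow> (nat \<Rightarrow> nat) \<Rightarrow> nat \<Rightarrow> nat \<Rightarrow> nat \<Rightarrow> int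
     \<Rightarrow> enat \<times> nat \<times> nat \<Rightarrow> int" where
  "level_shift q S p j k \<theta> B \<delta> = (\<lambda>(m, a, t).
     case m of
       \<infinity> \<Rightarrow> int (phi_le B (p k) \<delta> (j k - 1))
     | enat mk \<Rightarrow>
         if exceptional q p k \<theta>
         then int (U q S B 2 \<delta> mk 1 + 2 ^ (mk + 2) * t)
         else int (U q S B (p k) \<delta> mk a + p k ^ (mk + 1) * t))"

definition level_size :: "nat \<Rightarrow> (nat \<Rightarrow> nat) \<Rightarrow> (nat \<Rightarrow> nat) \<Rightarrow> nat \<Rightarrow> nat \<Rightarrow> enat \<Rightarrow> nat" where
  "level_size q p j k t m =
     (case m of
        \<infinity> \<Rightarrow> t
      | enat mk \<Rightarrow>
          if exceptional q p k t
          then (if mk = j k - 1 then t else 2 ^ max 1 (j k - mk - level_val q p k t) * t)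
          else p k ^ max 0 (j k - mk - level_val q p k t) * ((p k - 1) div power_index q (p k) t) * t)"

text \<open>Here \<theta> is the actual coset size, not the recursively computed one, so the level
  can be studied without the recursion. The condition \<open>two_first\<close> ensures that for
  \<open>l = 2\<close> every case with \<open>Q\<close> congruent to 3 modulo 4 is
  exceptional.\<close>

locale coset_level =
  fixes q :: nat and S :: "nat \<Rightarrow> nat \<Rightarrow> int \<Rightarrow> nat set" and p j :: "nat \<Rightarrow> nat"
    and k B l \<theta> :: nat and \<delta> :: int
  assumes q_gt_1: "1 < q" and choice: "representative_choice q S"
    and B: "0 < B" "coprime B q"
    and l_def: "l = p k" and l: "prime l" "\<not> l dvd q" "\<not> l dvd B"
    and j_pos: "1 \<le> j k" and two_first: "l = 2 \<Longrightarrow> k = 1"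
    and theta: "\<theta> = card (cyclotomic_coset q B \<delta>)"
begin

abbreviation "Q \<equiv> q ^ \<theta>"
abbreviation "exc \<equiv> exceptional q p k \<theta>"
abbreviation "r \<equiv> power_index q l \<theta>"
abbreviation "d \<equiv> ord l Q"
abbreviation "val \<equiv> level_val q p k \<theta>"
abbreviation "\<phi> \<equiv> phi B l \<delta>"

lemma coprime_qB: "coprime q B" using B by (simp add: coprime_commute)

lemma theta_pos: "0 < \<theta>"
  unfolding theta using card_cyclotomic_coset_pos B coprime_qB by blast

lemma period: "is_period q B \<delta> \<theta>"
  unfolding theta using is_period_card B coprime_qB by blast

lemma Q_gt_1: "1 < Q" using one_less_power[OF q_gt_1 theta_pos] .

lemma not_dvd_Q: "\<not> l dvd Q" using l prime_dvd_power by blast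

lemma l_gt_0: "0 < l" using l prime_gt_0_nat by blast

lemmas coprime_int_power = coprime_int_prime_power[OF l(1)]

lemma coprime_BL: "coprime B (l ^ n)"
  using l by (metis coprime_commute coprime_power_left_iff prime_imp_coprime)

lemma coprime_QL: "coprime Q (l ^ n)"
  using l(1) not_dvd_Q by (metis coprime_commute coprime_power_left_iff prime_imp_coprime)

lemma rd: "r * d = l - 1" using power_index_mult_ord l by blast

lemma d_pos: "0 < d"
  using l(1,2) by (simp add: prime_imp_coprime)

lemma r_pos: "0 < r"
  using rd prime_gt_1_nat[OF l(1)] by (metis gr0I mult_0 less_irrefl zero_less_diff)

text \<open>Filling in the first \<open>m\<close> digits makes the point divisible by
  \<open>l ^ m\<close>, and this is the quotient. By \<open>partial_cong\<close> the next digit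
  \<open>\<phi> m\<close> is the one value of \<open>u\<close> for which
  \<open>partial m + B * u\<close> is divisible by \<open>l\<close>; every other value fixes the
  valuation at exactly \<open>m\<close>.\<close>

definition partial where "partial m = (\<delta> + int B * int (\<Sum>k<m. \<phi> k * l ^ k)) div int l ^ m"

lemma partial_eq: "\<delta> + int B * int (\<Sum>k<m. \<phi> k * l ^ k) = int l ^ m * partial m"
  unfolding partial_def using phi_props(2)[OF l(1) B(1) l(3)] by simp

lemma partial_cong: "[partial m = - int B * int (\<phi> m)] (mod int l)"
proof -
  have "int l ^ Suc m dvd \<delta> + int B * int (\<Sum>k<Suc m. \<phi> k * l ^ k)"
    using phi_props(2)[OF l(1) B(1) l(3)] .
  also have "\<delta> + int B * int (\<Sum>k<Suc m. \<phi> k * l ^ k) = int l ^ m * (partial m + int B * int (\<phi> m))"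
    using partial_eq[of m] by (simp add: algebra_simps)
  finally have "int l ^ m * int l dvd int l ^ m * (partial m + int B * int (\<phi> m))"
    by (simp add: mult.commute)
  then show ?thesis using l_gt_0 by (simp add: cong_iff_dvd_diff)
qed

definition digit where
  "digit m a = (if l dvd Q - 1 then nth_smallest ({0..l - 1} - {\<phi> m}) a
     else (\<phi> m + nth_smallest (S B l \<delta>) a) mod l)"

lemma U_eq: "U q S B l \<delta> m a = (\<Sum>k<m. \<phi> k * l ^ k) + digit m a * l ^ m"
  by (simp add: U_def digit_def Let_def flip: theta)

definition base_unit where "base_unit m a = partial m + int B * int (digit m a)"

lemma phi_less: "\<phi> m < l" using phi_props(1)[OF l(1) B(1) l(3)] .

text \<open>The unit is \<open>B * (u - \<phi> m)\<close> modulo \<open>l\<close>, where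
  \<open>u\<close> is the chosen digit. If \<open>l\<close> divides \<open>Q - 1\<close>, orbits
  modulo \<open>l\<close> are single residues and every digit other than \<open>\<phi> m\<close> is
  required; otherwise \<open>u - \<phi> m\<close> runs through coset representatives, and
  multiplication by the unit \<open>B\<close> permutes the cosets.\<close>

lemma base_unit_spec:
  "a \<in> {1..r} \<Longrightarrow> \<not> int l dvd base_unit m a"
  "\<not> int l dvd w \<Longrightarrow> \<exists>!a. a \<in> {1..r} \<and> orbit_rel Q l w (base_unit m a)"
proof -
  have Bl: "\<not> int l dvd int B" using l(3) by simp
  have copB: "coprime (int B) (int l)" using coprime_int_power[OF Bl, of 1] by simp
  have shift: "[partial m + int B * x = int B * (x - int (\<phi> m))] (mod int l)" for x
    using partial_cong[of m] by (simp add: cong_iff_dvd_diff right_diff_distrib)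
  have "(a \<in> {1..r} \<longrightarrow> \<not> int l dvd base_unit m a) \<and>
    (\<not> int l dvd w \<longrightarrow> (\<exists>!a. a \<in> {1..r} \<and> orbit_rel Q l w (base_unit m a)))"
  proof (cases "l dvd Q - 1")
    case True
    let ?A = "{0..l - 1} - {\<phi> m}"
    have Q1: "[int Q = 1] (mod int l)"
      using True Q_gt_1 by (metis cong_iff_dvd_diff int_dvd_int_iff less_imp_le of_nat_1 of_nat_diff)
    then have "d = 1" using ord_eq_Suc_0_iff[of l Q] cong_int_iff[of Q 1 l] by simp
    then have r: "r = l - 1" using rd by simp
    have "card {0..l - 1} = l" using l_gt_0 by simp
    then have card: "card ?A = l - 1" using phi_less[of m] by (subst card_Diff_singleton) auto
    have bij: "bij_betw (nth_smallest ?A) {1..r} ?A"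
      using bij_betw_nth_smallest[of ?A] card r by simp
    have orb: "orbit_rel Q l x y \<longleftrightarrow> [x = y] (mod int l)" for x y
    proof
      assume "orbit_rel Q l x y"
      then obtain i where i: "[x * int Q ^ i = y] (mod int l)" by (auto simp: orbit_rel_def)
      have "[x * int Q ^ i = x * 1 ^ i] (mod int l)"
        by (intro cong_scalar_left cong_pow Q1)
      then show "[x = y] (mod int l)" using i by (metis cong_sym cong_trans mult_1_right power_one)
    qed (rule orbit_rel_cong_refl)
    have 1: "\<not> int l dvd partial m + int B * int u" if "u \<in> ?A" for u
    proof
      assume "int l dvd partial m + int B * int u"
      then have "int l dvd int B * (int u - int (\<phi> m))"
        using shift cong_dvd_iff by blast
      then have "int l dvd int u - int (\<phi> m)"
        using copB by (metis coprime_commute coprime_dvd_mult_right_iff)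
      then have "[u = \<phi> m] (mod l)" by (simp add: cong_iff_dvd_diff flip: cong_int_iff)
      moreover have "u < l" using that l_gt_0 by auto
      ultimately show False using that phi_less by (simp add: cong_def)
    qed
    have 2: "\<exists>!u. u \<in> ?A \<and> orbit_rel Q l w (partial m + int B * int u)" if w: "\<not> int l dvd w" for w
    proof -
      obtain n :: nat where "[int B * int n = w - partial m] (mod int l ^ 1)"
        using prime_solve_linear_cong[OF l(1) Bl] by blast
      moreover have "[int B * int (n mod l) = int B * int n] (mod int l)"
        by (intro cong_scalar_left) (simp add: cong_def zmod_int)
      ultimately have "[int B * int (n mod l) = w - partial m] (mod int l)"
        by (simp add: cong_trans)
      then have u: "[partial m + int B * int (n mod l) = w] (mod int l)"
        by (simp add: cong_iff_dvd_diff algebra_simps)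
      show ?thesis
      proof (rule ex1I)
        have "n mod l \<noteq> \<phi> m"
        proof
          assume "n mod l = \<phi> m"
          then have "[partial m + int B * int (n mod l) = 0] (mod int l)"
            using shift[of "int (\<phi> m)"] by simp
          then show False using u w by (metis cong_0_iff cong_dvd_iff dvd_0_right)
        qed
        then show "n mod l \<in> ?A \<and> orbit_rel Q l w (partial m + int B * int (n mod l))"
          using u l_gt_0 by (auto simp: orb cong_sym Suc_leI less_Suc_eq_le[symmetric])
      next
        fix u' assume u': "u' \<in> ?A \<and> orbit_rel Q l w (partial m + int B * int u')"
        then have "[partial m + int B * int u' = partial m + int B * int (n mod l)] (mod int l)"
          using u by (metis cong_sym cong_trans orb)
        then have "[int B * int u' = int B * int (n mod l)] (mod int l)"
          by (simp add: cong_add_lcancel)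
        then have "[int u' = int (n mod l)] (mod int l)"
          using copB cong_mult_lcancel by blast
        then have "[u' = n mod l] (mod l)" using cong_int_iff by blast
        moreover have "u' < l" using u' l_gt_0 by auto
        ultimately show "u' = n mod l" by (simp add: cong_def)
      qed
    qed
    show ?thesis
      using 1 2[THEN bij_betw_ex1[OF bij, of "\<lambda>u. orbit_rel Q l w (partial m + int B * int u)"]]
        bij_betw_apply[OF bij] True
      by (simp add: base_unit_def digit_def)
  next
    case False
    let ?A = "S B l \<delta>"
    have full: "full_representatives q l \<theta> ?A"
      using choice B l False unfolding representative_choice_def Let_def theta by blast
    have fin: "finite ?A" using full by (auto simp: full_representatives_def intro: finite_subset)
    have bij: "bij_betw (nth_smallest ?A) {1..r} ?A"
      using bij_betw_nth_smallest[OF fin] card_full_representatives[OF l(1,2) full] by simp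
    have c: "[partial m + int B * int ((\<phi> m + \<sigma>) mod l) = int B * int \<sigma>] (mod int l)" for \<sigma>
    proof -
      have "[int B * (int ((\<phi> m + \<sigma>) mod l) - int (\<phi> m)) = int B * ((int (\<phi> m) + int \<sigma>) - int (\<phi> m))] (mod int l)"
        by (intro cong_scalar_left cong_diff) (simp_all add: cong_def zmod_int)
      then show ?thesis using shift[of "int ((\<phi> m + \<sigma>) mod l)"] by (simp add: cong_trans)
    qed
    have 1: "\<not> int l dvd partial m + int B * int ((\<phi> m + \<sigma>) mod l)" if "\<sigma> \<in> ?A" for \<sigma>
    proof
      assume "int l dvd partial m + int B * int ((\<phi> m + \<sigma>) mod l)"
      then have "int l dvd int B * int \<sigma>" using c cong_dvd_iff by blast
      then have "l dvd \<sigma>" using copB by (metis coprime_commute coprime_dvd_mult_right_iff int_dvd_int_iff)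
      then show False using full_representatives_bounds[OF l(1,2) full that] by (auto dest: dvd_imp_le)
    qed
    have 2: "\<exists>!\<sigma>. \<sigma> \<in> ?A \<and> orbit_rel Q l w (partial m + int B * int ((\<phi> m + \<sigma>) mod l))"
      if w: "\<not> int l dvd w" for w
    proof -
      \<comment> \<open>Dividing \<open>w\<close> by \<open>B\<close> reduces the claim about base
        units to the one about the representatives themselves.\<close>
      obtain n :: nat where n: "[int B * int n = w] (mod int l ^ 1)"
        using prime_solve_linear_cong[OF l(1) Bl] by blast
      then have n': "[w = int B * int n] (mod int l)" using cong_sym by simp
      then have "\<not> int l dvd int n" using w cong_dvd_iff by fastforce
      then have "\<exists>!\<sigma>. \<sigma> \<in> ?A \<and> orbit_rel Q l (int n) (int \<sigma>)"
        using full_representatives_unique[OF l(1,2) full] by blast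
      moreover have "orbit_rel Q l w (partial m + int B * int ((\<phi> m + \<sigma>) mod l))
          \<longleftrightarrow> orbit_rel Q l (int n) (int \<sigma>)" for \<sigma>
        using orbit_rel_cong[OF n' c] orbit_rel_cmult[OF copB] by simp
      ultimately show ?thesis by simp
    qed
    show ?thesis
      using 1 2[THEN bij_betw_ex1[OF bij, of "\<lambda>\<sigma>. orbit_rel Q l w (partial m + int B * int ((\<phi> m + \<sigma>) mod l))"]]
        bij_betw_apply[OF bij] False
      by (simp add: base_unit_def digit_def)
  qed
  then show "a \<in> {1..r} \<Longrightarrow> \<not> int l dvd base_unit m a"
    "\<not> int l dvd w \<Longrightarrow> \<exists>!a. a \<in> {1..r} \<and> orbit_rel Q l w (base_unit m a)"
    by blast+
qed

text \<open>The precision fixed by \<open>m\<close> and \<open>a\<close> together: modulo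
  \<open>l\<close> in general, modulo 4 in the exceptional case. The term with \<open>t\<close>
  starts at this power and serves as the \<kappa> of the lifting.\<close>

definition kap where "kap = (if exc then 2 else 1 :: nat)"

definition unit_part where
  "unit_part m a t = base_unit m a + int B * int l ^ kap * int t"

abbreviation "choices \<equiv> level_choices q p j k \<theta>"
abbreviation "point I \<equiv> \<delta> + int B * level_shift q S p j k \<theta> B \<delta> I"

lemma exc_D: "exc \<Longrightarrow> l = 2" "exc \<Longrightarrow> [Q = 3] (mod 4)"
  by (auto simp: exceptional_def l_def)

lemma point_infinity: "int l ^ j k dvd point (\<infinity>, a, t)"
proof -
  have "{..j k - 1} = {..<j k}" using j_pos by auto
  then show ?thesis
    using phi_props(2)[OF l(1) B(1) l(3), of "j k" \<delta>]
    by (simp add: level_shift_def phi_le_def flip: l_def)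
qed

lemma choices_exc_D: "(enat m, a, t) \<in> choices \<Longrightarrow> exc \<Longrightarrow> a = 1"
  by (auto simp: level_choices_def Let_def)

lemma point_enat:
  assumes "(enat m, a, t) \<in> choices"
  shows "point (enat m, a, t) = int l ^ m * unit_part m a t"
proof -
  have "level_shift q S p j k \<theta> B \<delta> (enat m, a, t)
      = int (\<Sum>k<m. \<phi> k * l ^ k) + int (digit m a) * int l ^ m + int l ^ (m + kap) * int t"
  proof (cases exc)
    case True
    have "U q S B 2 \<delta> m 1 = (\<Sum>k<m. \<phi> k * l ^ k) + digit m a * l ^ m"
      using U_eq[of m a] choices_exc_D[OF assms True] exc_D(1)[OF True] by simp
    then show ?thesis using True exc_D(1) by (simp add: level_shift_def kap_def)
  next
    case False
    then show ?thesis by (simp add: level_shift_def kap_def U_eq flip: l_def)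
  qed
  then show ?thesis
    using partial_eq[of m] by (simp add: unit_part_def base_unit_def algebra_simps power_add)
qed

lemma choices_enat_iff:
  "(enat m, a, t) \<in> choices \<longleftrightarrow> m < j k \<and>
     (if exc then a = 1 \<and> t < 2 ^ min (val - 1) (j k - m - 2)
      else a \<in> {1..r} \<and> t < l ^ (min val (j k - m) - 1))"
proof -
  have "m \<le> j k - 1 \<longleftrightarrow> m < j k" using j_pos by auto
  moreover have "t \<le> x - 1 \<longleftrightarrow> t < x" if "0 < x" for x :: nat using that by auto
  ultimately show ?thesis
    using l_gt_0 by (auto simp: level_choices_def Let_def simp flip: l_def)
qed

lemma choices_a: "(enat m, a, t) \<in> choices \<Longrightarrow> a \<in> {1..r}"
  using r_pos by (auto simp: choices_enat_iff split: if_splits)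

lemma int_dvd_power_kap: "int l dvd int l ^ kap"
  by (simp add: kap_def)

lemma unit_part_unit:
  assumes "(enat m, a, t) \<in> choices"
  shows "\<not> int l dvd unit_part m a t"
proof -
  have "int l dvd int B * int l ^ kap * int t" using int_dvd_power_kap by simp
  then show ?thesis
    using base_unit_spec(1)[OF choices_a[OF assms]] by (simp add: unit_part_def dvd_add_left_iff)
qed

lemma Q_mod_4: "exc \<Longrightarrow> \<exists>n. Q = 4 * n + 3"
  using exc_D(2) by (metis cong_def div_mult_mod_eq mod_less mult.commute numeral_less_iff semiring_norm(76,78,81) )

lemma prime_power_decomp: "0 < x \<Longrightarrow> \<exists>c. x = l ^ multiplicity l x * c \<and> \<not> l dvd c"
proof -
  assume "0 < x"
  then have "x \<noteq> 0" "\<not> is_unit l" using prime_gt_1_nat[OF l(1)] by auto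
  from multiplicity_decompose'[OF this] show ?thesis by metis
qed

lemma prime_lift_exc:
  assumes exc "2 \<le> h"
  shows "\<exists>c. prime_lift 2 2 2 (val + 1) h Q c"
proof -
  obtain n where "Q = 4 * n + 3" using Q_mod_4 assms(1) by blast
  then show ?thesis using prime_lift_two assms by (simp add: level_val_def)
qed

lemma prime_lift_nonexc:
  assumes "\<not> exc" "1 \<le> h"
  shows "\<exists>c. prime_lift l 1 d val h Q c"
proof -
  \<comment> \<open>The exponent in \<open>level_val\<close> is thus \<open>\<theta> * d\<close>, so
    \<open>val\<close> is the valuation of \<open>Q ^ d - 1\<close>.\<close>
  have "\<theta> * (l - 1) div r = \<theta> * d" using rd r_pos by (metis mult.left_commute nonzero_mult_div_cancel_left not_gr0)
  then have val: "val = multiplicity l (Q ^ d - 1)"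
    using assms(1) by (simp add: level_val_def power_mult flip: l_def)
  have gt: "1 < Q ^ d" using one_less_power[OF Q_gt_1 d_pos] .
  obtain c where c: "Q ^ d - 1 = l ^ val * c" "\<not> l dvd c"
    using prime_power_decomp[of "Q ^ d - 1"] gt val by auto
  then have "Q ^ d = 1 + l ^ val * c" using gt by linarith
  then have eq: "int Q ^ d = 1 + int l ^ val * int c" by (metis of_nat_1 of_nat_add of_nat_mult of_nat_power)
  have "l ^ 1 dvd Q ^ d - 1" using cong_to_1_nat[OF ord[of Q l]] by simp
  then have v1: "1 \<le> val" unfolding val using gt prime_gt_1_nat[OF l(1)] by (intro multiplicity_geI) auto
  \<comment> \<open>For \<open>l = 2\<close> the level is the first one; not being exceptional then
    forces the odd number \<open>Q\<close> to be 1 modulo 4.\<close>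
  have two: "2 \<le> val" if l2: "l = 2"
  proof -
    have "k = 1" using two_first l2 by blast
    then have "\<not> [Q = 3] (mod 4)" using assms(1) l2 by (simp add: exceptional_def l_def)
    then have "Q mod 4 \<noteq> 3" by (simp add: cong_def)
    moreover have "odd Q" using not_dvd_Q l2 by simp
    ultimately have Q4: "Q mod 4 = 1" by presburger
    have "d = 1" using rd l2 by simp
    moreover have "2 ^ 2 dvd Q - 1" using Q4 by (simp add: mod_eq_dvd_iff_nat[symmetric] Q_gt_1 less_imp_le)
    ultimately show ?thesis unfolding val using Q_gt_1 l2 by (intro multiplicity_geI) auto
  qed
  have "prime_lift l 1 d val h Q (int c)"
    using l(1) v1 assms(2) not_dvd_Q c(2) two cong_ord_iff[of Q _ l] eq
    by unfold_locales (simp_all add: of_nat_power[symmetric] del: of_nat_power)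
  then show ?thesis by blast
qed

text \<open>The unit \<open>w\<close> is first moved onto a base unit at the low precision, modulo
  \<open>l\<close> or modulo 4; the lifting then supplies \<open>t\<close>. The two exponents add
  up.\<close>

lemma unit_exists:
  assumes m: "m < j k" and w: "\<not> int l dvd w"
  shows "\<exists>a t. (enat m, a, t) \<in> choices \<and> orbit_rel Q (l ^ (j k - m)) w (unit_part m a t)"
proof -
  define h where "h = j k - m"
  have Bl: "\<not> int l dvd int B" using l(3) by simp
  have wQ: "\<not> int l dvd w * int Q ^ i" for i
    using w not_dvd_Q l(1) by (metis int_dvd_int_iff of_nat_power prime_dvd_mult_iff prime_dvd_power prime_nat_int_transfer)
  obtain a i where a: "a \<in> {1..r}" and i: "[w * int Q ^ i = base_unit m a] (mod int l)"
    using base_unit_spec(2)[OF w, of m] unfolding orbit_rel_def by blast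
  show ?thesis
  proof (cases exc)
    case True
    then have l2: "l = 2" using exc_D by blast
    then have a1: "a = 1" using a rd by simp
    show ?thesis
    \<comment> \<open>Lifting with \<kappa> = 2 requires \<open>h \<ge> 2\<close>. For
      \<open>h = 1\<close> there is one unit class modulo 2, matching the single admissible
      \<open>t = 0\<close>.\<close>
    proof (cases "h = 1")
      case True
      then have "(enat m, 1, 0) \<in> choices" using \<open>exc\<close> m by (simp add: choices_enat_iff)
      moreover have "orbit_rel Q (l ^ (j k - m)) w (unit_part m 1 0)"
        using i True a1 by (auto simp: h_def unit_part_def intro: orbit_relI)
      ultimately show ?thesis by blast
    next
      case False
      then have h: "2 \<le> h" using m by (simp add: h_def)
      then obtain c where "prime_lift 2 2 2 (val + 1) h Q c" using prime_lift_exc True by blast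
      then interpret L: prime_lift 2 2 2 "val + 1" h Q c .
      obtain n where n: "Q = 4 * n + 3" using Q_mod_4 True by blast
      have odd: "odd (base_unit m 1)" using base_unit_spec(1)[of 1 m] a a1 l2 by simp
      have "odd w" using w l2 by simp
      from odd_orbit_mod_4[OF n this odd]
      obtain i where i: "[w * int Q ^ i = base_unit m 1] (mod int 2 ^ 2)" ..
      obtain t i' where t: "t < 2 ^ (min (val + 1) h - 2)"
        and ti: "[w * int Q ^ i * int Q ^ (2 * i') = base_unit m 1 + int B * int 2 ^ 2 * int t] (mod int 2 ^ h)"
        using L.lift_exists[of "int B" "w * int Q ^ i" "base_unit m 1"] Bl wQ i l2 by auto
      have "min (val + 1) h - 2 = min (val - 1) (h - 2)" by simp
      then have "(enat m, 1, t) \<in> choices" using t True m by (simp add: choices_enat_iff h_def)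
      moreover have "unit_part m 1 t = base_unit m 1 + int B * int 2 ^ 2 * int t"
        unfolding unit_part_def kap_def using True l2 by simp
      moreover have "orbit_rel Q (2 ^ h) w (base_unit m 1 + int B * int 2 ^ 2 * int t)"
        using ti by (intro orbit_relI[of _ _ "i + 2 * i'"]) (simp add: power_add mult.assoc)
      moreover have "l ^ (j k - m) = 2 ^ h" by (simp add: l2 h_def)
      ultimately show ?thesis by metis
    qed
  next
    case False
    have h: "1 \<le> h" using m by (simp add: h_def)
    then obtain c where "prime_lift l 1 d val h Q c" using prime_lift_nonexc False by blast
    then interpret L: prime_lift l 1 d val h Q c .
    obtain t i' where t: "t < l ^ (min val h - 1)"
      and ti: "[w * int Q ^ i * int Q ^ (d * i') = base_unit m a + int B * int l ^ 1 * int t] (mod int l ^ h)"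
      using L.lift_exists[of "int B" "w * int Q ^ i" "base_unit m a"] Bl wQ i by auto
    have "(enat m, a, t) \<in> choices" using t False m a by (simp add: choices_enat_iff h_def)
    moreover have "orbit_rel Q (l ^ (j k - m)) w (unit_part m a t)"
      using ti False by (auto simp: h_def unit_part_def kap_def power_add mult.assoc intro!: orbit_relI[of _ _ "i + d * i'"])
    ultimately show ?thesis by blast
  qed
qed

text \<open>The term with \<open>t\<close> vanishes modulo \<open>l\<close>, so reduction modulo
  \<open>l\<close> recovers \<open>a\<close>; with a common base unit, \<open>lift_unique\<close>
  recovers \<open>t\<close>.\<close>

lemma unit_unique:
  assumes c: "(enat m, a, t) \<in> choices" and c': "(enat m, a', t') \<in> choices"
    and rel: "orbit_rel Q (l ^ (j k - m)) (unit_part m a t) (unit_part m a' t')"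
  shows "a = a' \<and> t = t'"
proof -
  define h where "h = j k - m"
  have m: "m < j k" using c by (simp add: choices_enat_iff)
  have Bl: "\<not> int l dvd int B" using l(3) by simp
  have aa: "a = a'"
  proof -
    have "l dvd l ^ (j k - m)" using m by simp
    then have "orbit_rel Q l (unit_part m a t) (unit_part m a' t')" using rel orbit_rel_dvd by blast
    moreover have "[unit_part m a t = base_unit m a] (mod int l)" for a t
      using int_dvd_power_kap by (simp add: unit_part_def cong_iff_dvd_diff)
    ultimately have "orbit_rel Q l (base_unit m a) (base_unit m a')" using orbit_rel_cong by blast
    moreover have "orbit_rel Q l (base_unit m a) (base_unit m a)" by (rule orbit_rel_cong_refl) simp
    ultimately show ?thesis
      using base_unit_spec(2)[OF base_unit_spec(1)[OF choices_a[OF c]], of m m] choices_a[OF c] choices_a[OF c']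
      by blast
  qed
  have bu: "\<not> int l dvd base_unit m a" using base_unit_spec(1)[OF choices_a[OF c]] .
  have "t = t'"
  proof (cases exc)
    case True
    then have l2: "l = 2" using exc_D by blast
    show ?thesis
    proof (cases "h = 1")
      case True
      then show ?thesis using c c' \<open>exc\<close> by (simp add: choices_enat_iff h_def)
    next
      case False
      then have h: "2 \<le> h" using m by (simp add: h_def)
      then obtain c0 where "prime_lift 2 2 2 (val + 1) h Q c0" using prime_lift_exc True by blast
      then interpret L: prime_lift 2 2 2 "val + 1" h Q c0 .
      have "min (val + 1) h - 2 = min (val - 1) (h - 2)" by simp
      then have "t < 2 ^ (min (val + 1) h - 2)" "t' < 2 ^ (min (val + 1) h - 2)"
        using c c' True by (simp_all add: choices_enat_iff h_def)
      moreover have up: "unit_part m a t = base_unit m a + int B * int 2 ^ 2 * int t" for t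
        unfolding unit_part_def kap_def using True l2 by simp
      have "orbit_rel Q (2 ^ h) (base_unit m a + int B * int 2 ^ 2 * int t)
          (base_unit m a + int B * int 2 ^ 2 * int t')"
        using rel unfolding aa[symmetric] up by (simp add: l2 h_def)
      ultimately show ?thesis
        using L.lift_unique[of "int B" "base_unit m a" t t'] Bl bu unfolding l2 by blast
    qed
  next
    case False
    have h: "1 \<le> h" using m by (simp add: h_def)
    then obtain c0 where "prime_lift l 1 d val h Q c0" using prime_lift_nonexc False by blast
    then interpret L: prime_lift l 1 d val h Q c0 .
    have "t < l ^ (min val h - 1)" "t' < l ^ (min val h - 1)"
      using c c' False by (simp_all add: choices_enat_iff h_def)
    then show ?thesis
      using L.lift_unique[of "int B" "base_unit m a" t t'] Bl bu rel aa False
      by (simp add: unit_part_def kap_def h_def)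
  qed
  with aa show ?thesis by blast
qed

section \<open>Orbits above \<delta>: existence and uniqueness of the parameters\<close>

lemma point_cong: "[point I = \<delta>] (mod int B)"
  by (simp add: cong_iff_dvd_diff)

lemma level_exists:
  assumes "orbit_rel q B w \<delta>"
  shows "\<exists>I\<in>choices. orbit_rel q (B * l ^ j k) w (point I)"
proof -
  obtain i where i: "[w * int q ^ i = \<delta>] (mod int B)" using assms by (auto simp: orbit_rel_def)
  \<comment> \<open>The point is moved along its orbit until it agrees with \<delta> modulo
    \<open>B\<close>, as the splitting in \<open>orbit_rel_mult_iff\<close> requires.\<close>
  define w' where "w' = w * int q ^ i"
  have "\<exists>I\<in>choices. orbit_rel Q (l ^ j k) w' (point I)"
  \<comment> \<open>The parameter \<open>m\<close> is the valuation of \<open>w'\<close>, with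
    \<infinity> standing for valuation at least \<open>j k\<close>.\<close>
  proof (cases "int l ^ j k dvd w'")
    case True
    have "(\<infinity>, 0, 0) \<in> choices" by (simp add: level_choices_def)
    moreover have "orbit_rel Q (l ^ j k) w' (point (\<infinity>, 0, 0))"
      using True point_infinity[of 0 0] by (intro orbit_rel_cong_refl) (simp add: cong_iff_dvd_diff)
    ultimately show ?thesis by blast
  next
    case False
    then have "w' \<noteq> 0" by auto
    moreover have "\<not> is_unit (int l)" using prime_gt_1_nat[OF l(1)] by simp
    ultimately obtain x where x: "w' = int l ^ multiplicity (int l) w' * x" "\<not> int l dvd x"
      using multiplicity_decompose'[of w' "int l"] by metis
    define m where "m = multiplicity (int l) w'"
    have m: "m < j k"
      using False x(1) by (metis dvd_mult2 le_imp_power_dvd m_def not_less)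
    obtain a t where at: "(enat m, a, t) \<in> choices" "orbit_rel Q (l ^ (j k - m)) x (unit_part m a t)"
      using unit_exists[OF m x(2)] by blast
    then have "orbit_rel Q (l ^ j k) w' (point (enat m, a, t))"
      using m l_gt_0 x(1) by (simp only: point_enat m_def[symmetric]) (simp add: orbit_rel_scale_prime_power)
    then show ?thesis using at(1) by blast
  qed
  then obtain I where I: "I \<in> choices" "orbit_rel Q (l ^ j k) w' (point I)" by blast
  then have "orbit_rel q (B * l ^ j k) w' (point I)"
    using orbit_rel_mult_iff[OF period coprime_BL, of w' "point I"] point_cong i by (simp add: w'_def)
  moreover have "orbit_rel q (B * l ^ j k) w w'" by (rule orbit_relI[of _ _ i]) (simp add: w'_def)
  ultimately show ?thesis using I(1) orbit_rel_trans by blast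
qed

lemma choices_cases:
  assumes "I \<in> choices"
  obtains "I = (\<infinity>, 0, 0)" | m a t where "I = (enat m, a, t)" "m < j k"
  using assms j_pos by (cases I) (auto simp: level_choices_def)

lemma dvd_orbit_iff:
  assumes "n \<le> j k" "orbit_rel Q (l ^ j k) x y"
  shows "int l ^ n dvd x \<longleftrightarrow> int l ^ n dvd y"
proof -
  have "orbit_rel Q (l ^ n) x y" using assms orbit_rel_dvd le_imp_power_dvd by blast
  then obtain i where "[x * int Q ^ i = y] (mod int l ^ n)" by (auto simp: orbit_rel_def)
  then have "int l ^ n dvd x * int Q ^ i \<longleftrightarrow> int l ^ n dvd y" by (rule cong_dvd_iff)
  moreover have "coprime (int l ^ n) (int Q ^ i)"
    using coprime_QL[of n] by (metis coprime_commute coprime_int_iff coprime_power_right_iff of_nat_power)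
  ultimately show ?thesis using coprime_dvd_mult_left_iff by blast
qed

lemma dvd_point_enat_iff:
  assumes "(enat m, a, t) \<in> choices"
  shows "int l ^ n dvd point (enat m, a, t) \<longleftrightarrow> n \<le> m"
proof
  assume "n \<le> m"
  then show "int l ^ n dvd point (enat m, a, t)"
    unfolding point_enat[OF assms] by (intro dvd_mult2 le_imp_power_dvd)
next
  assume dvd: "int l ^ n dvd point (enat m, a, t)"
  show "n \<le> m"
  proof (rule ccontr)
    assume "\<not> n \<le> m"
    then have "int l ^ Suc m dvd int l ^ n" by (intro le_imp_power_dvd) simp
    then have "int l ^ m * int l dvd int l ^ m * unit_part m a t"
      using dvd unfolding point_enat[OF assms] by (metis dvd_trans power_Suc2)
    then show False using unit_part_unit[OF assms] l_gt_0 by simp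
  qed
qed

text \<open>Multiplying by a power of \<open>Q\<close> preserves the valuation capped at
  \<open>j k\<close>, so equivalent points share \<open>m\<close>; cancelling \<open>l ^ m\<close>
  leaves a comparison of unit parts modulo \<open>l ^ (j k - m)\<close>.\<close>

lemma level_unique:
  assumes I: "I \<in> choices" and I': "I' \<in> choices"
    and rel: "orbit_rel q (B * l ^ j k) (point I) (point I')"
  shows "I = I'"
proof -
  have rel: "orbit_rel Q (l ^ j k) (point I) (point I')"
    using rel orbit_rel_mult_iff[OF period coprime_BL] point_cong by blast
  have dvd: "int l ^ n dvd point I \<longleftrightarrow> int l ^ n dvd point I'" if "n \<le> j k" for n
    using dvd_orbit_iff that rel by blast
  show ?thesis
  proof (rule choices_cases[OF I]; rule choices_cases[OF I'])
    fix m a t m' a' t'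
    assume eq: "I = (enat m, a, t)" "m < j k" "I' = (enat m', a', t')" "m' < j k"
    have "n \<le> m \<longleftrightarrow> n \<le> m'" if "n \<le> j k" for n
      using dvd[OF that] dvd_point_enat_iff I I' unfolding eq by blast
    from this[of m] this[of m'] have mm: "m = m'" using eq by simp
    have "orbit_rel Q (l ^ j k) (int l ^ m * unit_part m a t) (int l ^ m * unit_part m a' t')"
      using rel point_enat I I' unfolding eq mm by metis
    then have "orbit_rel Q (l ^ (j k - m)) (unit_part m a t) (unit_part m a' t')"
      using orbit_rel_scale_prime_power[OF l_gt_0, of m "j k"] eq by simp
    then show "I = I'" using unit_unique I I' unfolding eq mm by blast
  next
    fix m a t
    assume eq: "I = (enat m, a, t)" "m < j k" "I' = (\<infinity>, 0, 0)"
    then have "j k \<le> m" using dvd[of "j k"] point_infinity dvd_point_enat_iff I by blast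
    then show "I = I'" using eq by simp
  next
    fix m a t
    assume eq: "I = (\<infinity>, 0, 0)" "I' = (enat m, a, t)" "m < j k"
    then have "j k \<le> m" using dvd[of "j k"] point_infinity dvd_point_enat_iff I' by blast
    then show "I = I'" using eq by simp
  qed simp
qed

text \<open>After cancelling \<open>l ^ m\<close> and the unit part, fixing the point modulo
  \<open>l ^ j k\<close> just means that the power of \<open>Q\<close> is 1 modulo
  \<open>l ^ (j k - m)\<close>.\<close>

lemma unit_period:
  assumes "m < j k" "(enat m, a, t) \<in> choices"
    and "\<And>i. [int Q ^ i = 1] (mod int l ^ (j k - m)) \<longleftrightarrow> \<eta> dvd i"
  shows "is_period Q (l ^ j k) (point (enat m, a, t)) \<eta>"
  unfolding is_period_def
proof
  fix i
  let ?x = "unit_part m a t"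
  have "[int l ^ m * (?x * int Q ^ i) = int l ^ m * ?x] (mod int (l ^ j k))
      \<longleftrightarrow> [?x * int Q ^ i = ?x * 1] (mod int (l ^ (j k - m)))"
    using cong_scale_prime_power[OF l_gt_0, of m "j k"] assms(1) by simp
  also have "\<dots> \<longleftrightarrow> [int Q ^ i = 1] (mod int l ^ (j k - m))"
    using cong_mult_lcancel[OF coprime_int_power[OF unit_part_unit[OF assms(2)], of "j k - m"],
        of "int Q ^ i" 1] by simp
  finally show "[point (enat m, a, t) * int Q ^ i = point (enat m, a, t)] (mod int (l ^ j k)) \<longleftrightarrow> \<eta> dvd i"
    unfolding point_enat[OF assms(2)] using assms(3) by (simp add: mult.assoc)
qed

text \<open>The size is \<theta> times the order of \<open>Q\<close> modulo
  \<open>l ^ (j k - m)\<close>, by \<open>power_cong_1_iff\<close>. This validates the recursion for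
  \<open>tau\<close> and supplies the \<theta> of the next level.\<close>

lemma level_period:
  assumes "(m, a, t) \<in> choices"
  shows "card (cyclotomic_coset q (B * l ^ j k) (point (m, a, t))) = level_size q p j k \<theta> m"
proof -
  have "\<exists>\<eta>. is_period Q (l ^ j k) (point (m, a, t)) \<eta> \<and> level_size q p j k \<theta> m = \<theta> * \<eta>"
  proof (cases m)
    case infinity
    have "is_period Q (l ^ j k) (point (\<infinity>, a, t)) 1"
      using point_infinity[of a t] by (simp add: is_period_def cong_iff_dvd_diff dvd_mult2)
    then show ?thesis by (auto simp: level_size_def infinity)
  next
    case (enat mk)
    then have mk: "mk < j k" using assms by (simp add: choices_enat_iff)
    define h where "h = j k - mk"
    show ?thesis
    proof (cases exc)
      case True
      then have l2: "l = 2" using exc_D by blast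
      show ?thesis
      proof (cases "h = 1")
        case True
        \<comment> \<open>Only the modulus 2 remains, on which the odd number \<open>Q\<close> acts
          trivially; this is the separate value at \<open>m = j - 1\<close>.\<close>
        have "[int Q ^ i = 1] (mod int l ^ (j k - mk)) \<longleftrightarrow> 1 dvd i" for i
        proof -
          have "odd (int Q ^ i)" using not_dvd_Q l2 by simp
          then have "2 dvd int Q ^ i - 1" by simp
          then show ?thesis using True l2 by (simp add: h_def cong_iff_dvd_diff)
        qed
        then have "is_period Q (l ^ j k) (point (m, a, t)) 1"
          using unit_period mk assms enat by blast
        moreover have "level_size q p j k \<theta> m = \<theta> * 1"
          using True \<open>exc\<close> mk by (auto simp: level_size_def enat h_def)
        ultimately show ?thesis by blast
      next
        case False
        then have h: "2 \<le> h" using mk by (simp add: h_def)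
        then obtain c0 where "prime_lift 2 2 2 (val + 1) h Q c0" using prime_lift_exc True by blast
        then interpret L: prime_lift 2 2 2 "val + 1" h Q c0 .
        have "2 \<le> val + 1" using L.kappa by simp
        \<comment> \<open>The order is \<open>d = 2\<close> times
          \<open>2 ^ (h - (val + 1))\<close>; the extra factor 2 is absorbed into the maximum with
          1.\<close>
        then have "max 1 (h - val) = Suc (h - (val + 1))" by auto
        then have e: "2 * 2 ^ (h - (val + 1)) = (2::nat) ^ max 1 (h - val)" by simp
        have "is_period Q (l ^ j k) (point (m, a, t)) (2 ^ max 1 (h - val))"
          using unit_period[OF mk, of a t "2 ^ max 1 (h - val)"] assms enat L.power_cong_1_iff l2
          unfolding e by (simp add: h_def)
        moreover have "level_size q p j k \<theta> m = \<theta> * 2 ^ max 1 (h - val)"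
          using True h by (auto simp: level_size_def enat h_def)
        ultimately show ?thesis by blast
      qed
    next
      case False
      have h: "1 \<le> h" using mk by (simp add: h_def)
      then obtain c0 where "prime_lift l 1 d val h Q c0" using prime_lift_nonexc False by blast
      then interpret L: prime_lift l 1 d val h Q c0 .
      have "is_period Q (l ^ j k) (point (m, a, t)) (d * l ^ (h - val))"
        using unit_period[OF mk, of a t] assms enat L.power_cong_1_iff by (simp add: h_def)
      moreover have "(l - 1) div r = d" using rd r_pos by (metis nonzero_mult_div_cancel_left not_gr0)
      then have "level_size q p j k \<theta> m = \<theta> * (d * l ^ (h - val))"
        using False by (simp add: level_size_def enat h_def flip: l_def)
      ultimately show ?thesis by blast
    qed
  qed
  then obtain \<eta> where "is_period Q (l ^ j k) (point (m, a, t)) \<eta>" "level_size q p j k \<theta> m = \<theta> * \<eta>"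
    by blast
  then have "is_period q (B * l ^ j k) (point (m, a, t)) (level_size q p j k \<theta> m)"
    using is_period_mult[OF period coprime_BL point_cong] by simp
  moreover have "coprime q (B * l ^ j k)"
    using coprime_qB l by (metis coprime_commute coprime_mult_right_iff coprime_power_left_iff prime_imp_coprime)
  ultimately show ?thesis using is_period_imp_card B(1) l_gt_0 by simp
qed

end

section \<open>Trees of orbits\<close>

text \<open>The induction common to the primes \<open>p_k\<close> and the primes dividing
  \<open>g\<close>. A path is a total function of which only the first \<open>k\<close> entries
  matter at depth \<open>k\<close>; the children may depend on earlier entries, as the later ranges
  depend on the earlier \<open>m\<close>.\<close>

locale orbit_tree =
  fixes q s :: nat and M :: "nat \<Rightarrow> nat" and v :: "(nat \<Rightarrow> 'a) \<Rightarrow> nat \<Rightarrow> int"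
    and Ch :: "(nat \<Rightarrow> 'a) \<Rightarrow> nat \<Rightarrow> 'a set"
  assumes v_cong: "\<And>x y k. (\<forall>i\<in>{1..k}. x i = y i) \<Longrightarrow> v x k = v y k"
    and Ch_cong: "\<And>x y k. (\<forall>i\<in>{1..k}. x i = y i) \<Longrightarrow> Ch x (Suc k) = Ch y (Suc k)"
    and v_step: "\<And>x k. k < s \<Longrightarrow> [v x (Suc k) = v x k] (mod int (M k))"
    and M_dvd: "\<And>k. k < s \<Longrightarrow> M k dvd M (Suc k)"
    and child_exists: "\<And>x k w. k < s \<Longrightarrow> \<forall>i\<in>{1..k}. x i \<in> Ch x i \<Longrightarrow> orbit_rel q (M k) w (v x k) \<Longrightarrow>
      \<exists>c\<in>Ch x (Suc k). orbit_rel q (M (Suc k)) w (v (x(Suc k := c)) (Suc k))"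
    and child_unique: "\<And>x k c c'. k < s \<Longrightarrow> \<forall>i\<in>{1..k}. x i \<in> Ch x i \<Longrightarrow>
      c \<in> Ch x (Suc k) \<Longrightarrow> c' \<in> Ch x (Suc k) \<Longrightarrow>
      orbit_rel q (M (Suc k)) (v (x(Suc k := c)) (Suc k)) (v (x(Suc k := c')) (Suc k)) \<Longrightarrow> c = c'"
begin

lemma node_exists:
  assumes "orbit_rel q (M 0) w (v x0 0)" "k \<le> s"
  shows "\<exists>x. (\<forall>i\<in>{1..k}. x i \<in> Ch x i) \<and> orbit_rel q (M k) w (v x k)"
  using assms(2)
proof (induction k)
  case 0
  then show ?case using assms(1) by auto
next
  case (Suc k)
  then obtain x where x: "\<forall>i\<in>{1..k}. x i \<in> Ch x i" "orbit_rel q (M k) w (v x k)" by auto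
  then obtain c where c: "c \<in> Ch x (Suc k)" "orbit_rel q (M (Suc k)) w (v (x(Suc k := c)) (Suc k))"
    using child_exists[of k x w] Suc(2) by auto
  have "(x(Suc k := c)) i \<in> Ch (x(Suc k := c)) i" if i: "i \<in> {1..Suc k}" for i
  proof -
    obtain n where n: "i = Suc n" "n \<le> k" using i by (cases i) auto
    have "Ch (x(Suc k := c)) (Suc n) = Ch x (Suc n)" using n by (intro Ch_cong) auto
    then show ?thesis using n x(1) c(1) by (cases "n = k") auto
  qed
  then show ?case using c(2) by blast
qed

text \<open>Reduced modulo the previous modulus, the last entry no longer shows, so the earlier
  entries agree by induction. Both last entries are then children of the same node.\<close>

lemma node_unique:
  assumes "\<forall>i\<in>{1..k}. x i \<in> Ch x i" "\<forall>i\<in>{1..k}. y i \<in> Ch y i" "k \<le> s"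
    and "orbit_rel q (M k) (v x k) (v y k)"
  shows "\<forall>i\<in>{1..k}. x i = y i"
  using assms
proof (induction k)
  case (Suc k)
  have "orbit_rel q (M k) (v x (Suc k)) (v y (Suc k))"
    using Suc.prems orbit_rel_dvd M_dvd by (meson Suc_le_lessD)
  then have "orbit_rel q (M k) (v x k) (v y k)"
    using orbit_rel_cong[OF v_step v_step] Suc.prems(3) by (meson Suc_le_lessD)
  then have eq: "\<forall>i\<in>{1..k}. x i = y i" using Suc by simp
  have "v (x(Suc k := x (Suc k))) (Suc k) = v x (Suc k)" by simp
  moreover have "v (x(Suc k := y (Suc k))) (Suc k) = v y (Suc k)"
    using eq by (intro v_cong) (auto simp: le_Suc_eq)
  moreover have "x (Suc k) \<in> Ch x (Suc k)" using Suc.prems(1) by simp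
  moreover have "y (Suc k) \<in> Ch x (Suc k)" using Suc.prems(2) Ch_cong[of k x y] eq by simp
  ultimately have "x (Suc k) = y (Suc k)"
    using child_unique[of k x "x (Suc k)" "y (Suc k)"] Suc.prems by simp
  then show ?case using eq by (auto simp: le_Suc_eq)
qed simp

end

section \<open>The general construction\<close>

lemma tau_Suc:
  "tau q p j N0 \<gamma> m (Suc i) = level_size q p j (Suc i) (tau q p j N0 \<gamma> m i) (m (Suc i))"
  by (simp add: level_size_def Let_def)

lemma gamma_level_Suc:
  "gamma_level q S p j N0 \<gamma> (m, a, t) (Suc i) =
     gamma_level q S p j N0 \<gamma> (m, a, t) i + int (level_modulus p j N0 (Suc i)) *
       level_shift q S p j (Suc i) (tau q p j N0 \<gamma> m i) (level_modulus p j N0 (Suc i))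
         (gamma_level q S p j N0 \<gamma> (m, a, t) i) (m (Suc i), a (Suc i), t (Suc i))"
  by (simp only: gamma_level.simps Let_def level_shift_def prod.case)

lemmas [simp del] = tau.simps(2) gamma_level.simps(2)

lemma tau_cong: "\<forall>i\<in>{1..k}. m i = m' i \<Longrightarrow> tau q p j N0 \<gamma> m k = tau q p j N0 \<gamma> m' k"
  by (induction k) (simp_all add: tau_Suc)

lemma gamma_level_cong:
  "\<forall>i\<in>{1..k}. m i = m' i \<and> a i = a' i \<and> t i = t' i \<Longrightarrow>
     gamma_level q S p j N0 \<gamma> (m, a, t) k = gamma_level q S p j N0 \<gamma> (m', a', t') k"
proof (induction k)
  case (Suc k)
  have "tau q p j N0 \<gamma> m k = tau q p j N0 \<gamma> m' k" using Suc.prems by (intro tau_cong) auto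
  then show ?case using Suc by (simp add: gamma_level_Suc)
qed simp

text \<open>An index becomes a path of admissible entries, one triple per level, apart from
  extensionality.\<close>

lemma index_set_iff:
  "(m, a, t) \<in> index_set q s p j N0 \<gamma> \<longleftrightarrow>
     m \<in> extensional {1..s} \<and> a \<in> extensional {1..s} \<and> t \<in> extensional {1..s} \<and>
     (\<forall>k\<in>{1..s}. (m k, a k, t k) \<in> level_choices q p j k (tau q p j N0 \<gamma> m (k - 1)))"
  unfolding index_set_def level_choices_def r_level_def v_level_def PiE_def Pi_def
  by (auto simp only: mem_Collect_eq prod.case Int_iff UNIV_I Ball_def)

locale general_construction =
  fixes q s :: nat and S :: "nat \<Rightarrow> nat \<Rightarrow> int \<Rightarrow> nat set" and p j :: "nat \<Rightarrow> nat"
    and N0 :: nat and \<gamma> :: int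
  assumes q_gt_1: "1 < q" and choice: "representative_choice q S"
    and N0: "0 < N0" "coprime N0 q"
    and p: "\<And>k. k \<in> {1..s} \<Longrightarrow> prime (p k) \<and> \<not> p k dvd q \<and> \<not> p k dvd N0"
    and j: "\<And>k. k \<in> {1..s} \<Longrightarrow> 1 \<le> j k"
    and p_mono: "strict_mono_on {1..s} p"
begin

abbreviation "modulus k \<equiv> level_modulus p j N0 (Suc k)"
text \<open>Paths are sequences of triples, whereas indices are triples of sequences; this converts
  the former into the latter.\<close>

abbreviation "triple x \<equiv> (\<lambda>i. fst (x i), \<lambda>i. fst (snd (x i)), \<lambda>i. snd (snd (x i)))"
abbreviation "node x k \<equiv> gamma_level q S p j N0 \<gamma> (triple x) k"
abbreviation "coset_size x k \<equiv> tau q p j N0 \<gamma> (\<lambda>i. fst (x i)) k"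
abbreviation "children x k \<equiv> level_choices q p j k (coset_size x (k - 1))"

lemma modulus_Suc: "modulus (Suc k) = modulus k * p (Suc k) ^ j (Suc k)"
  by (simp add: level_modulus_def atLeastLessThanSuc mult_ac)

lemma modulus_0: "modulus 0 = N0"
  by (simp add: level_modulus_def)

lemma node_Suc:
  "node x (Suc k) = node x k + int (modulus k) *
     level_shift q S p j (Suc k) (coset_size x k) (modulus k) (node x k) (x (Suc k))"
  by (simp add: gamma_level_Suc)

lemma node_upd: "node (x(Suc k := c)) (Suc k) = node x k + int (modulus k) *
     level_shift q S p j (Suc k) (coset_size x k) (modulus k) (node x k) c"
proof -
  have "node (x(Suc k := c)) k = node x k" by (rule gamma_level_cong) auto
  moreover have "coset_size (x(Suc k := c)) k = coset_size x k" by (rule tau_cong) auto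
  ultimately show ?thesis by (simp add: node_Suc)
qed

lemma modulus_props:
  "k \<le> s \<Longrightarrow> 0 < modulus k \<and> coprime (modulus k) q \<and> (\<forall>i\<in>{Suc k..s}. \<not> p i dvd modulus k)"
proof (induction k)
  case 0
  then show ?case using N0 p by (simp add: modulus_0)
next
  case (Suc k)
  have pk: "prime (p (Suc k))" "\<not> p (Suc k) dvd q" using p[of "Suc k"] Suc(2) by auto
  then have "coprime (p (Suc k)) q" by (simp add: prime_imp_coprime)
  moreover have "\<not> p i dvd p (Suc k) ^ j (Suc k)" if i: "i \<in> {Suc (Suc k)..s}" for i
  proof
    assume "p i dvd p (Suc k) ^ j (Suc k)"
    then have "p i dvd p (Suc k)" using p[of i] i prime_dvd_power by auto
    then have "p i = p (Suc k)" using p[of i] i pk(1) by (simp add: primes_dvd_imp_eq)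
    moreover have "p (Suc k) < p i" using i by (intro strict_mono_onD[OF p_mono]) auto
    ultimately show False by simp
  qed
  ultimately show ?case
    using Suc pk(1) p by (auto simp: modulus_Suc prime_dvd_mult_iff prime_gt_0_nat)
qed

lemma coset_level:
  assumes "k < s" "card (cyclotomic_coset q (modulus k) (node x k)) = coset_size x k"
  shows "coset_level q S p j (Suc k) (modulus k) (p (Suc k)) (coset_size x k) (node x k)"
proof
  \<comment> \<open>The primes increase, so 2 can only come first.\<close>
  show "Suc k = 1" if "p (Suc k) = 2"
  proof (rule ccontr)
    assume "Suc k \<noteq> 1"
    then have "p 1 < p (Suc k)" using assms(1) by (intro strict_mono_onD[OF p_mono]) auto
    moreover have "2 \<le> p 1" using p[of 1] assms(1) by (intro prime_ge_2_nat) auto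
    ultimately show False using that by simp
  qed
qed (use assms q_gt_1 choice modulus_props[of k] p[of "Suc k"] j[of "Suc k"] in auto)

text \<open>Level by level: the correct size at depth \<open>k\<close> is what permits the analysis
  of level \<open>k + 1\<close>, whose \<open>level_period\<close> gives the size there.\<close>

lemma card_node:
  "k \<le> s \<Longrightarrow> \<forall>i\<in>{1..k}. x i \<in> children x i \<Longrightarrow>
    card (cyclotomic_coset q (modulus k) (node x k)) = coset_size x k"
proof (induction k)
  case (Suc k)
  then have IH: "card (cyclotomic_coset q (modulus k) (node x k)) = coset_size x k" by simp
  interpret L: coset_level q S p j "Suc k" "modulus k" "p (Suc k)" "coset_size x k" "node x k"
    using coset_level IH Suc.prems by simp
  obtain m a t where x: "x (Suc k) = (m, a, t)" by (cases "x (Suc k)")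
  have "x (Suc k) \<in> children x (Suc k)" using Suc.prems(2) by (rule bspec) simp
  then have "(m, a, t) \<in> level_choices q p j (Suc k) (coset_size x k)" using x by simp
  from L.level_period[OF this] show ?case
    by (simp only: modulus_Suc node_Suc tau_Suc x fst_conv)
qed (simp add: modulus_0)

sublocale orbit_tree q s modulus node children
proof
  fix x y :: "nat \<Rightarrow> enat \<times> nat \<times> nat" and k :: nat
  assume eq: "\<forall>i\<in>{1..k}. x i = y i"
  then show "node x k = node y k" by (intro gamma_level_cong) simp
  show "children x (Suc k) = children y (Suc k)"
    using eq tau_cong[of k "\<lambda>i. fst (x i)" "\<lambda>i. fst (y i)"] by simp
next
  fix x :: "nat \<Rightarrow> enat \<times> nat \<times> nat" and k :: nat
  show "[node x (Suc k) = node x k] (mod int (modulus k))"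
    by (simp add: node_Suc cong_iff_dvd_diff)
next
  fix k show "modulus k dvd modulus (Suc k)" by (simp add: modulus_Suc)
next
  fix x :: "nat \<Rightarrow> enat \<times> nat \<times> nat" and k :: nat and w
  assume k: "k < s" and x: "\<forall>i\<in>{1..k}. x i \<in> children x i"
  interpret L: coset_level q S p j "Suc k" "modulus k" "p (Suc k)" "coset_size x k" "node x k"
    using coset_level card_node k x by simp
  show "\<exists>c\<in>children x (Suc k). orbit_rel q (modulus (Suc k)) w (node (x(Suc k := c)) (Suc k))"
    if "orbit_rel q (modulus k) w (node x k)"
    using L.level_exists[OF that] by (simp only: node_upd modulus_Suc diff_Suc_1)
  show "c = c'" if "c \<in> children x (Suc k)" "c' \<in> children x (Suc k)"
    "orbit_rel q (modulus (Suc k)) (node (x(Suc k := c)) (Suc k)) (node (x(Suc k := c')) (Suc k))" for c c'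
    using L.level_unique[of c c'] that by (simp only: node_upd modulus_Suc diff_Suc_1)
qed

lemma index_exists:
  assumes "orbit_rel q N0 w \<gamma>"
  shows "\<exists>I\<in>index_set q s p j N0 \<gamma>. orbit_rel q (modulus s) w (gamma_level q S p j N0 \<gamma> I s)"
proof -
  have "orbit_rel q (modulus 0) w (node undefined 0)" using assms by (simp add: modulus_0)
  then obtain x where x: "\<forall>i\<in>{1..s}. x i \<in> children x i" "orbit_rel q (modulus s) w (node x s)"
    using node_exists[of w undefined s] by blast
  \<comment> \<open>Path entries outside \<open>{1..s}\<close> are arbitrary; restriction makes the
    sequences extensional without changing the node.\<close>
  define m a t where "m = restrict (\<lambda>i. fst (x i)) {1..s}"
    and "a = restrict (\<lambda>i. fst (snd (x i))) {1..s}"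
    and "t = restrict (\<lambda>i. snd (snd (x i))) {1..s}"
  have "gamma_level q S p j N0 \<gamma> (m, a, t) s = node x s"
    by (rule gamma_level_cong) (simp add: m_def a_def t_def)
  moreover have "(m, a, t) \<in> index_set q s p j N0 \<gamma>"
    unfolding index_set_iff
  proof (intro conjI ballI)
    fix k assume k: "k \<in> {1..s}"
    have "tau q p j N0 \<gamma> m (k - 1) = coset_size x (k - 1)"
      using k by (intro tau_cong) (auto simp: m_def)
    then show "(m k, a k, t k) \<in> level_choices q p j k (tau q p j N0 \<gamma> m (k - 1))"
      using x(1) k by (simp add: m_def a_def t_def)
  qed (simp_all add: m_def a_def t_def)
  ultimately show ?thesis using x(2) by (intro bexI[of _ "(m, a, t)"]) simp_all
qed

lemma index_unique:
  assumes I: "I \<in> index_set q s p j N0 \<gamma>" and I': "I' \<in> index_set q s p j N0 \<gamma>"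
    and rel: "orbit_rel q (modulus s) (gamma_level q S p j N0 \<gamma> I s) (gamma_level q S p j N0 \<gamma> I' s)"
  shows "I = I'"
proof -
  obtain m a t m' a' t' where eq: "I = (m, a, t)" "I' = (m', a', t')" by (cases I; cases I') blast
  define x y where "x = (\<lambda>i. (m i, a i, t i))" and "y = (\<lambda>i. (m' i, a' i, t' i))"
  have "\<forall>i\<in>{1..s}. x i = y i"
    using I I' rel unfolding eq index_set_iff
    by (intro node_unique) (simp_all add: x_def y_def)
  then have "m i = m' i \<and> a i = a' i \<and> t i = t' i" if "i \<in> {1..s}" for i
    using that by (auto simp: x_def y_def)
  then show ?thesis
    using I I' unfolding eq index_set_iff by (auto intro!: extensionalityI)
qed

lemma gamma_level_cong_base: "k \<le> s \<Longrightarrow> [gamma_level q S p j N0 \<gamma> I k = \<gamma>] (mod int N0)"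
proof (induction k)
  case (Suc k)
  obtain m a t where I: "I = (m, a, t)" by (cases I) blast
  have "int N0 dvd int (modulus k)" by (simp add: level_modulus_def)
  then have "[gamma_level q S p j N0 \<gamma> I (Suc k) = gamma_level q S p j N0 \<gamma> I k] (mod int N0)"
    unfolding I gamma_level_Suc by (simp add: cong_iff_dvd_diff)
  then show ?case using Suc cong_trans by simp
qed (cases I, simp)

end

section \<open>The base representatives\<close>

text \<open>Each \<open>l\<close>-th power gains a factor \<open>l\<close>, since \<open>l\<close>
  divides the modulus reached so far. Only this lower bound is needed, so \<open>l = 2\<close>
  requires no special care.\<close>

lemma cong_power_prime_power:
  fixes q l n g :: nat
  assumes "[int q = 1] (mod int g)" "l dvd g"
  shows "[int q ^ (l ^ n) = 1] (mod int (g * l ^ n))"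
proof (induction n)
  case 0
  then show ?case using assms(1) by simp
next
  case (Suc n)
  define m where "m = g * l ^ n"
  obtain x where x: "int q ^ (l ^ n) = 1 + int m * x"
    using Suc by (metis cong_iff_lin cong_sym m_def)
  obtain R where R: "(1 + int m * x) ^ l
      = 1 + int l * (int m * x) + int (l choose 2) * (int m * x)\<^sup>2 + R * (int m * x) ^ 3"
    using one_plus_power_expand by blast
  have "l dvd m" using assms(2) by (simp add: m_def)
  then have "int m * int l dvd int m * int m" by (intro mult_dvd_mono) auto
  then have d: "int m * int l dvd (int m * x)\<^sup>2"
    by (simp add: power2_eq_square mult_ac dvd_mult)
  have "(1 + int m * x) ^ l - 1 = int m * int l * x + (int (l choose 2) + R * (int m * x)) * (int m * x)\<^sup>2"
    unfolding R by (simp add: power2_eq_square power3_eq_cube algebra_simps)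
  then have "int m * int l dvd (1 + int m * x) ^ l - 1" using d by simp
  then have "[int q ^ (l ^ n * l) = 1] (mod int m * int l)"
    by (simp add: cong_iff_dvd_diff power_mult x)
  then show ?case by (simp add: m_def mult_ac)
qed

lemma power_cong_of_exponent_cong:
  fixes q M n :: nat
  assumes "[int q ^ n = 1] (mod int M)" "[i = j] (mod n)"
  shows "[int q ^ i = int q ^ j] (mod int M)"
proof -
  have *: "[int q ^ i = int q ^ (i mod n)] (mod int M)" for i
  proof -
    have "[(int q ^ n) ^ (i div n) * int q ^ (i mod n) = 1 ^ (i div n) * int q ^ (i mod n)] (mod int M)"
      by (intro cong_scalar_right cong_pow assms(1))
    then show ?thesis by (simp flip: power_mult power_add)
  qed
  show ?thesis using *[of i] *[of j] assms(2) by (metis cong_def cong_sym cong_trans)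
qed

locale base_construction =
  fixes q g u :: nat and gs es fs :: "nat \<Rightarrow> nat"
  assumes q_gt_1: "1 < q" and g_pos: "0 < g" and g_dvd: "g dvd q - 1"
    and g_eq: "g = (\<Prod>k\<in>{1..u}. gs k ^ es k)"
    and gs: "\<And>k. k \<in> {1..u} \<Longrightarrow> prime (gs k)"
    and gs_mono: "strict_mono_on {1..u} gs"
    and es: "\<And>k. k \<in> {1..u} \<Longrightarrow> 1 \<le> es k"
begin

abbreviation "special k \<equiv> k = 1 \<and> gs 1 = 2 \<and> [q = 3] (mod 4)"
definition cofactor where "cofactor k = (\<Prod>i\<in>{1..k}. gs i ^ fs i)"
abbreviation "modulus k \<equiv> g * cofactor k"
abbreviation "node x k \<equiv> gamma_base q g k gs fs x"
abbreviation "children k \<equiv> {0..gs k ^ y_exp q gs es fs k - 1}"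

lemma q_cong_1: "[int q = 1] (mod int g)"
  using g_dvd q_gt_1 by (metis cong_iff_dvd_diff int_dvd_int_iff less_imp_le of_nat_1 of_nat_diff)

lemma q_pow_cong_1: "[int q ^ i = 1] (mod int g)"
  using cong_pow[OF q_cong_1, of i] by simp

lemma coprime_qg: "coprime q g"
proof -
  have "coprime (q - 1) q" using coprime_diff_one_left_nat[of q] q_gt_1 by simp
  from coprime_divisors[OF g_dvd dvd_refl this] show ?thesis by (rule coprime_commute[THEN iffD1])
qed

lemma cofactor_Suc: "cofactor (Suc k) = cofactor k * gs (Suc k) ^ fs (Suc k)"
  by (simp add: cofactor_def)

lemma gs_distinct: "i \<in> {1..u} \<Longrightarrow> k \<in> {1..u} \<Longrightarrow> gs i = gs k \<Longrightarrow> i = k"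
  using strict_mono_on_imp_inj_on[OF gs_mono] by (auto dest: inj_onD)

lemma gs_dvd_g: "k \<in> {1..u} \<Longrightarrow> gs k ^ es k dvd g"
  unfolding g_eq by (rule dvd_prodI) auto

lemma gs_dvd_g': "k \<in> {1..u} \<Longrightarrow> gs k dvd g"
  using gs_dvd_g es by (metis dvd_power_le dvd_refl dvd_trans power_one_right)

lemma gs_not_dvd_q: "k \<in> {1..u} \<Longrightarrow> \<not> gs k dvd q"
  using coprime_qg gs gs_dvd_g' by (meson coprime_common_divisor not_prime_unit)

lemma coprime_gs: "i \<in> {1..u} \<Longrightarrow> k \<in> {1..u} \<Longrightarrow> i \<noteq> k \<Longrightarrow> coprime (gs i) (gs k)"
  using gs gs_distinct primes_coprime by metis

lemma g_decomp:
  assumes "k \<in> {1..u}"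
  shows "\<exists>g'. g = gs k ^ es k * g' \<and> coprime (gs k) g'"
proof -
  have "g = gs k ^ es k * (\<Prod>i\<in>{1..u} - {k}. gs i ^ es i)"
    unfolding g_eq using assms by (simp add: prod.remove)
  moreover have "coprime (gs k) (\<Prod>i\<in>{1..u} - {k}. gs i ^ es i)"
    using coprime_gs[OF assms] by (intro prod_coprime_right) auto
  ultimately show ?thesis by blast
qed

lemma coprime_cofactor: "k < u \<Longrightarrow> coprime (gs (Suc k)) (cofactor k)"
  unfolding cofactor_def using coprime_gs[of "Suc k"] by (intro prod_coprime_right) auto

lemma modulus_props: "k \<le> u \<Longrightarrow> 0 < modulus k \<and> coprime (modulus k) q"
proof (induction k)
  case 0
  then show ?case using g_pos coprime_qg by (simp add: cofactor_def coprime_commute)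
next
  case (Suc k)
  have "prime (gs (Suc k))" "\<not> gs (Suc k) dvd q" using gs gs_not_dvd_q Suc.prems by auto
  then have "coprime (gs (Suc k)) q" "0 < gs (Suc k)" by (auto simp: prime_imp_coprime prime_gt_0_nat)
  then show ?case using Suc by (simp add: cofactor_Suc)
qed

text \<open>Exponents divisible by \<open>cofactor k\<close> act trivially modulo
  \<open>modulus k\<close>. They provide the freedom to move at a new prime without disturbing the
  earlier ones.\<close>

lemma q_pow_cofactor: "k \<le> u \<Longrightarrow> [int q ^ cofactor k = 1] (mod int (modulus k))"
proof (induction k)
  case 0
  then show ?case using q_cong_1 by (simp add: cofactor_def)
next
  case (Suc k)
  then have IH: "[int (q ^ cofactor k) = 1] (mod int (modulus k))" by simp
  have "gs (Suc k) dvd modulus k" using gs_dvd_g' Suc.prems by simp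
  from cong_power_prime_power[OF IH this, of "fs (Suc k)"]
  show ?case by (simp add: cofactor_Suc power_mult mult.assoc)
qed

lemma node_Suc:
  "node x (Suc k) = node x k + int g *
     ((if special (Suc k) then 2 else int (cofactor k)) * int (x (Suc k)))"
proof -
  have "(\<Prod>i\<in>{1..<Suc k}. int (gs i ^ fs i)) = int (cofactor k)"
    by (simp add: cofactor_def atLeastLessThanSuc_atLeastAtMost)
  then show ?thesis by (auto simp: gamma_base_def algebra_simps)
qed

lemma node_upd: "node (x(Suc k := c)) (Suc k) = node x k + int g *
     ((if special (Suc k) then 2 else int (cofactor k)) * int c)"
proof -
  have "node (x(Suc k := c)) k = node x k"
    unfolding gamma_base_def by (intro arg_cong2[where f = "(+)"] arg_cong2[where f = "(*)"] sum.cong) auto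
  then show ?thesis by (simp only: node_Suc fun_upd_same)
qed

lemma node_cong_1: "[node x k = 1] (mod int g)"
  by (simp add: gamma_base_def cong_iff_dvd_diff)

lemma child_iff: "k \<in> {1..u} \<Longrightarrow> c \<in> children k \<longleftrightarrow> c < gs k ^ y_exp q gs es fs k"
proof -
  assume "k \<in> {1..u}"
  then have "0 < gs k ^ y_exp q gs es fs k" using gs[of k] by (simp add: prime_gt_0_nat)
  then show ?thesis unfolding atLeastAtMost_iff by linarith
qed

section \<open>A prime divisor of \<open>g\<close> outside the special case\<close>

context
  fixes k :: nat
  assumes k: "k < u"
begin

abbreviation "l \<equiv> gs (Suc k)"
abbreviation "e \<equiv> es (Suc k)"
abbreviation "f \<equiv> fs (Suc k)"

lemma Suc_k: "Suc k \<in> {1..u}" using k by simp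
lemma prime_l: "prime l" using gs Suc_k .
lemma l_not_dvd_q: "\<not> l dvd q" using gs_not_dvd_q Suc_k .

lemma node_unit: "\<not> int l dvd node x k"
proof
  assume "int l dvd node x k"
  moreover have "[node x k = 1] (mod int l)"
    using node_cong_1 gs_dvd_g'[OF Suc_k] cong_dvd_modulus by (metis int_dvd_int_iff)
  ultimately have "int l dvd 1" using cong_dvd_iff by blast
  then show False using prime_gt_1_nat[OF prime_l] by simp
qed

text \<open>Since \<open>l ^ e\<close> divides \<open>q - 1\<close>, the order of \<open>q\<close>
  modulo \<open>l ^ e\<close> is 1, so \<kappa> is \<open>e\<close>; the precision
  \<open>e + f\<close> is the full exponent of \<open>l\<close> in the new modulus.\<close>

lemma regular_prime_lift:
  assumes "\<not> special (Suc k)"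
  shows "\<exists>c. prime_lift l e 1 (multiplicity l (q - 1)) (e + f) q c"
proof -
  define v where "v = multiplicity l (q - 1)"
  have "q - 1 \<noteq> 0" "\<not> is_unit l" using q_gt_1 prime_gt_1_nat[OF prime_l] by auto
  note nz = this
  from multiplicity_decompose'[OF nz] obtain c where c: "q - 1 = l ^ v * c" "\<not> l dvd c"
    unfolding v_def by metis
  have ev: "e \<le> v" unfolding v_def
    using gs_dvd_g[OF Suc_k] g_dvd dvd_trans nz by (intro multiplicity_geI) auto
  have "q = 1 + l ^ v * c" using c(1) q_gt_1 by linarith
  then have qc: "int q = 1 + int l ^ v * int c" by (metis of_nat_1 of_nat_add of_nat_mult of_nat_power)
  have "[int q ^ i = 1] (mod int l ^ e)" for i
    using cong_dvd_modulus[OF q_pow_cong_1, of "int (l ^ e)" i] gs_dvd_g[OF Suc_k]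
    by (metis int_dvd_int_iff of_nat_power)
  note ord = this
  \<comment> \<open>As 2 can only be the first prime, failing to be special leaves \<open>q\<close>
    congruent to 1 modulo 4.\<close>
  have two: "2 \<le> v" if l2: "l = 2"
  proof -
    have "Suc k = 1"
    proof (rule ccontr)
      assume "Suc k \<noteq> 1"
      then have "gs 1 < gs (Suc k)" using k by (intro strict_mono_onD[OF gs_mono]) auto
      moreover have "2 \<le> gs 1" using gs[of 1] k by (intro prime_ge_2_nat) auto
      ultimately show False using l2 by simp
    qed
    then have "q mod 4 \<noteq> 3" using assms l2 by (auto simp: cong_def)
    moreover have "odd q" using l_not_dvd_q l2 by simp
    ultimately have "q mod 4 = 1" by presburger
    then have "2 ^ 2 dvd q - 1" using q_gt_1 by (simp add: mod_eq_dvd_iff_nat[symmetric])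
    then show ?thesis unfolding v_def using nz l2 by (intro multiplicity_geI) auto
  qed
  have "prime_lift l e 1 v (e + f) q (int c)"
    using prime_l es[OF Suc_k] ev l_not_dvd_q ord qc c(2) two by unfold_locales auto
  then show ?thesis unfolding v_def by blast
qed

lemma modulus_decomp:
  "\<exists>B'. modulus k = l ^ e * B' \<and> coprime l B' \<and> 0 < B'"
proof -
  obtain g' where g': "g = l ^ e * g'" "coprime l g'" using g_decomp[OF Suc_k] by blast
  have "modulus k = l ^ e * (g' * cofactor k)" using g'(1) by simp
  moreover have "coprime l (g' * cofactor k)" using g'(2) coprime_cofactor[OF k] by simp
  moreover have "0 < g' * cofactor k" using modulus_props[of k] k g'(1) by simp
  ultimately show ?thesis by blast
qed

lemma coprime_not_dvd: "coprime l B' \<Longrightarrow> \<not> int l dvd int B'"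
  using prime_l by (metis coprime_absorb_left int_dvd_int_iff not_prime_unit)

lemma regular_bound:
  assumes "\<not> special (Suc k)"
  shows "c \<in> children (Suc k) \<longleftrightarrow> c < l ^ (min (multiplicity l (q - 1)) (e + f) - e)"
proof -
  have "y_exp q gs es fs (Suc k) = min (multiplicity l (q - 1)) (e + f) - e"
    using assms by (auto simp: y_exp_def)
  then show ?thesis using child_iff[OF Suc_k] by simp
qed

text \<open>The lifting yields an exponent that works modulo \<open>l ^ h\<close> only. It is
  replaced by one with the same effect there that acts trivially modulo the old modulus.\<close>

lemma regular_exists:
  assumes special: "\<not> special (Suc k)" and w: "orbit_rel q (modulus k) w (node x k)"
  shows "\<exists>c\<in>children (Suc k). orbit_rel q (modulus (Suc k)) w (node (x(Suc k := c)) (Suc k))"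
proof -
  define v h where "v = multiplicity l (q - 1)" and "h = e + f"
  obtain c0 where "prime_lift l e 1 v h q c0" using regular_prime_lift[OF special] by (auto simp: v_def h_def)
  then interpret L: prime_lift l e 1 v h q c0 .
  obtain B' where B': "modulus k = l ^ e * B'" "coprime l B'" using modulus_decomp by blast
  obtain n where n: "[w * int q ^ n = node x k] (mod int (modulus k))"
    using w by (auto simp: orbit_rel_def)
  define w' where "w' = w * int q ^ n"
  have w'l: "[w' = node x k] (mod int l ^ e)"
    using cong_dvd_modulus[OF n, of "int (l ^ e)"] B'(1) by (simp add: w'_def)
  have "\<not> int l dvd w'"
  proof -
    have "int l dvd int l ^ e" using es[OF Suc_k] by (simp add: dvd_power)
    then have "[w' = node x k] (mod int l)" using w'l cong_dvd_modulus by blast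
    then show ?thesis using node_unit cong_dvd_iff by blast
  qed
  from L.lift_exists[OF coprime_not_dvd[OF B'(2)] this w'l]
  obtain t i where t: "t < l ^ (min v h - e)"
    and i: "[w' * int q ^ i = node x k + int B' * int l ^ e * int t] (mod int l ^ h)"
    by auto
  have c: "t \<in> children (Suc k)" using t regular_bound[OF special] by (simp add: v_def h_def)
  have up: "node (x(Suc k := t)) (Suc k) = node x k + int (modulus k) * int t"
    using special by (simp only: node_upd) simp
  have "coprime (l ^ h) (cofactor k)" using coprime_cofactor[OF k] by simp
  \<comment> \<open>Modulo \<open>l ^ h\<close> the power depends only on the exponent modulo
    \<open>l ^ h\<close>, and modulo \<open>modulus k\<close> only on the exponent modulo
    \<open>cofactor k\<close>; these two numbers are coprime.\<close>
  then obtain i' where i': "[i' = i] (mod l ^ h)" "[i' = 0] (mod cofactor k)"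
    using binary_chinese_remainder_nat by blast
  have "[int q ^ (l ^ h) = 1] (mod int (l ^ h))"
    using cong_power_prime_power[OF q_cong_1 gs_dvd_g'[OF Suc_k], of h]
    by (rule cong_dvd_modulus) simp
  from power_cong_of_exponent_cong[OF this i'(1)]
  have "[w' * int q ^ i' = w' * int q ^ i] (mod int (l ^ h))" by (rule cong_scalar_left)
  then have 1: "[w' * int q ^ i' = node x k + int (modulus k) * int t] (mod int (l ^ h))"
    using i by (simp add: B'(1) mult_ac) (metis cong_trans)
  have "[int q ^ i' = 1] (mod int (modulus k))"
    using power_cong_of_exponent_cong[OF q_pow_cofactor i'(2)] k by simp
  from cong_mult[OF n this] have "[w' * int q ^ i' = node x k] (mod int (modulus k))"
    by (simp only: w'_def mult_1_right)
  moreover have "[node x k = node x k + int (modulus k) * int t] (mod int (modulus k))"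
    by (simp add: cong_iff_dvd_diff)
  ultimately have "[w' * int q ^ i' = node x k + int (modulus k) * int t] (mod int (modulus k))"
    by (rule cong_trans)
  then have 2: "[w' * int q ^ i' = node x k + int (modulus k) * int t] (mod int B')"
    by (rule cong_dvd_modulus) (metis B'(1) dvd_triv_right int_dvd_int_iff)
  have "coprime B' (l ^ h)" using B'(2) by (simp add: coprime_commute)
  moreover have "modulus (Suc k) = B' * l ^ h"
    using B'(1) by (simp add: cofactor_Suc h_def power_add mult_ac)
  ultimately have "[w' * int q ^ i' = node x k + int (modulus k) * int t] (mod int (modulus (Suc k)))"
    using 1 2 by (metis cong_mult_modulus_int)
  then have "[w * int q ^ (n + i') = node (x(Suc k := t)) (Suc k)] (mod int (modulus (Suc k)))"
    unfolding up by (simp add: w'_def power_add mult.assoc)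
  then show ?thesis using c orbit_relI by blast
qed

text \<open>The full \<open>l\<close>-part of the new modulus suffices: there the increment is
  \<open>l ^ e\<close> times the unit \<open>B'\<close>, as \<open>lift_unique\<close>
  expects.\<close>

lemma regular_unique:
  assumes special: "\<not> special (Suc k)" and c: "c \<in> children (Suc k)" "c' \<in> children (Suc k)"
    and rel: "orbit_rel q (modulus (Suc k)) (node (x(Suc k := c)) (Suc k)) (node (x(Suc k := c')) (Suc k))"
  shows "c = c'"
proof -
  define v h where "v = multiplicity l (q - 1)" and "h = e + f"
  obtain c0 where "prime_lift l e 1 v h q c0" using regular_prime_lift[OF special] by (auto simp: v_def h_def)
  then interpret L: prime_lift l e 1 v h q c0 .
  obtain B' where B': "modulus k = l ^ e * B'" "coprime l B'" using modulus_decomp by blast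
  have up: "node (x(Suc k := t)) (Suc k) = node x k + int B' * int l ^ e * int t" for t
  proof -
    have "node (x(Suc k := t)) (Suc k) = node x k + int (modulus k) * int t"
      using special by (simp only: node_upd) simp
    then show ?thesis by (simp add: B'(1) mult_ac)
  qed
  have "modulus (Suc k) = B' * l ^ h"
    using B'(1) by (simp add: cofactor_Suc h_def power_add mult_ac)
  then have "l ^ h dvd modulus (Suc k)" by simp
  then have "orbit_rel q (l ^ h) (node x k + int B' * int l ^ e * int c) (node x k + int B' * int l ^ e * int c')"
    using rel unfolding up by (rule orbit_rel_dvd)
  then show ?thesis
    using c regular_bound[OF special] coprime_not_dvd[OF B'(2)] node_unit
    by (intro L.lift_unique[of "int B'" "node x k"]) (simp_all add: v_def h_def)
qed

end

section \<open>The first prime 2 when \<open>q\<close> is congruent to 3 modulo 4\<close>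

context
  assumes u: "0 < u" and special: "special 1"
begin

text \<open>Here \<open>q - 1\<close> is not divisible by 4, so its divisor \<open>g\<close>
  contains 2 exactly once.\<close>

lemma special_decomp: "\<exists>g' n. g = 2 * g' \<and> odd g' \<and> q = 4 * n + 3 \<and> es 1 = 1"
proof -
  have one: "1 \<in> {1..u}" using u by simp
  obtain n where n: "q = 4 * n + 3"
    using special by (metis cong_def mod_less div_mult_mod_eq mult.commute numeral_less_iff semiring_norm(76,78,81))
  have "\<not> 4 dvd q - 1" using n by presburger
  have "es 1 = 1"
  proof (rule ccontr)
    assume "es 1 \<noteq> 1"
    then have "2 \<le> es 1" using es[OF one] by simp
    then have "(2::nat) ^ 2 dvd 2 ^ es 1" by (rule le_imp_power_dvd)
    then have "4 dvd q - 1" using gs_dvd_g[OF one] g_dvd special by (auto intro: dvd_trans)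
    then show False using \<open>\<not> 4 dvd q - 1\<close> by blast
  qed
  then show ?thesis using g_decomp[OF one] n special by (auto simp: coprime_left_2_iff_odd)
qed

text \<open>With \<open>es 1 = 1\<close> the exponent \<open>y\<close> is the
  \<open>min v h - \<kappa>\<close> of the lifting, for \<open>\<kappa> = 2\<close>,
  \<open>h = 1 + fs 1\<close> and \<open>v\<close> one more than the valuation of
  \<open>q + 1\<close>. If \<open>fs 1 = 0\<close>, then \<open>h\<close> is too small and the
  modulus does not grow.\<close>

lemma special_bound:
  "0 < fs 1 \<Longrightarrow> c \<in> children 1 \<longleftrightarrow> c < 2 ^ (min (multiplicity 2 (q + 1) + 1) (1 + fs 1) - 2)"
  "fs 1 = 0 \<Longrightarrow> c \<in> children 1 \<longleftrightarrow> c = 0"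
proof -
  have one: "1 \<in> {1..u}" using u by simp
  have "es 1 = 1" using special_decomp by blast
  then have "y_exp q gs es fs 1 = min (multiplicity 2 (q + 1) + 1) (1 + fs 1) - 2" if "0 < fs 1"
    using special that by (simp add: y_exp_def)
  then show "0 < fs 1 \<Longrightarrow> c \<in> children 1 \<longleftrightarrow> c < 2 ^ (min (multiplicity 2 (q + 1) + 1) (1 + fs 1) - 2)"
    using child_iff[OF one] special by simp
  have "y_exp q gs es fs 1 = 0" if "fs 1 = 0" using special that by (simp add: y_exp_def)
  then show "fs 1 = 0 \<Longrightarrow> c \<in> children 1 \<longleftrightarrow> c = 0" by simp
qed

lemma special_node: "node (x(Suc 0 := c)) (Suc 0) = 1 + int g * (2 * int c)"
  using special by (simp only: node_upd) (simp add: gamma_base_def)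

lemma special_modulus: "modulus (Suc 0) = g * 2 ^ fs 1" "modulus 0 = g"
  using special by (simp_all add: cofactor_def)

text \<open>Every power of \<open>q\<close> is 1 modulo \<open>g\<close>, hence modulo its odd part
  \<open>g'\<close>, so an exponent found modulo \<open>2 ^ h\<close> needs no correction.\<close>

lemma special_exists:
  assumes w: "orbit_rel q g w 1"
  shows "\<exists>c\<in>children (Suc 0). orbit_rel q (modulus (Suc 0)) w (node (x(Suc 0 := c)) (Suc 0))"
proof (cases "fs 1 = 0")
  case True
  then show ?thesis
    using w special_bound(2) by (intro bexI[of _ 0]) (simp_all only: special_node special_modulus, simp_all)
next
  case False
  obtain g' m where g': "g = 2 * g'" "odd g'" and m: "q = 4 * m + 3" using special_decomp by blast
  define h where "h = 1 + fs 1"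
  have "2 \<le> h" using False by (simp add: h_def)
  then obtain c0 where "prime_lift 2 2 2 (multiplicity 2 (q + 1) + 1) h q c0"
    using prime_lift_two m by blast
  then interpret L: prime_lift 2 2 2 "multiplicity 2 (q + 1) + 1" h q c0 .
  obtain n where n: "[w * int q ^ n = 1] (mod int g)" using w by (auto simp: orbit_rel_def)
  define w' where "w' = w * int q ^ n"
  have w'g: "[w' * int q ^ i = 1] (mod int g)" for i
    using cong_mult[OF n q_pow_cong_1, of i] by (simp add: w'_def)
  have "2 dvd int g" using g' by simp
  then have "2 dvd w' - 1" using w'g[of 0] unfolding cong_iff_dvd_diff by (metis dvd_trans mult_1_right power_0)
  then have "odd w'" by simp
  then obtain i0 where i0: "[w' * int q ^ i0 = 1] (mod int 2 ^ 2)" using odd_orbit_mod_4[OF m, of w' 1] by auto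
  have "\<not> int 2 dvd w' * int q ^ i0" using \<open>odd w'\<close> m by simp
  moreover have "\<not> int 2 dvd int g'" using g' by simp
  ultimately obtain t i where t: "t < 2 ^ (min (multiplicity 2 (q + 1) + 1) h - 2)"
    and i: "[w' * int q ^ i0 * int q ^ (2 * i) = 1 + int g' * int 2 ^ 2 * int t] (mod int 2 ^ h)"
    using L.lift_exists[of "int g'" "w' * int q ^ i0" 1] i0 by blast
  have c: "t \<in> children (Suc 0)" using t special_bound(1)[of t] False by (simp add: h_def)
  \<comment> \<open>The extra factor 2 in the special base representative turns the increment into
    \<open>2 ^ 2 * g'\<close>, matching \<kappa> = 2 with the unit \<open>g'\<close>.\<close>
  have eq: "1 + int g' * int 2 ^ 2 * int t = 1 + int g * (2 * int t)" by (simp add: g'(1))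
  have 1: "[w' * int q ^ (i0 + 2 * i) = 1 + int g * (2 * int t)] (mod int (2 ^ h))"
    using i unfolding eq by (simp add: power_add mult.assoc)
  have "[1 + int g * (2 * int t) = 1] (mod int g)" by (simp add: cong_iff_dvd_diff)
  then have "[w' * int q ^ (i0 + 2 * i) = 1 + int g * (2 * int t)] (mod int g)"
    using w'g cong_sym cong_trans by blast
  then have 2: "[w' * int q ^ (i0 + 2 * i) = 1 + int g * (2 * int t)] (mod int g')"
    by (rule cong_dvd_modulus) (simp add: g'(1))
  have "coprime g' (2 ^ h)" using g' by simp
  moreover have "modulus (Suc 0) = g' * 2 ^ h" unfolding special_modulus by (simp add: g'(1) h_def)
  ultimately have "[w' * int q ^ (i0 + 2 * i) = 1 + int g * (2 * int t)] (mod int (modulus (Suc 0)))"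
    using 1 2 by (metis cong_mult_modulus_int)
  then have "[w * int q ^ (n + (i0 + 2 * i)) = node (x(Suc 0 := t)) (Suc 0)] (mod int (modulus (Suc 0)))"
    unfolding special_node by (simp add: w'_def power_add mult.assoc)
  then show ?thesis using c orbit_relI by blast
qed

lemma special_unique:
  assumes c: "c \<in> children (Suc 0)" "c' \<in> children (Suc 0)"
    and rel: "orbit_rel q (modulus (Suc 0)) (node (x(Suc 0 := c)) (Suc 0)) (node (x(Suc 0 := c')) (Suc 0))"
  shows "c = c'"
proof (cases "fs 1 = 0")
  case True
  then show ?thesis using c special_bound(2) by simp
next
  case False
  obtain g' m where g': "g = 2 * g'" "odd g'" and m: "q = 4 * m + 3" using special_decomp by blast
  define h where "h = 1 + fs 1"
  have "2 \<le> h" using False by (simp add: h_def)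
  then obtain c0 where "prime_lift 2 2 2 (multiplicity 2 (q + 1) + 1) h q c0"
    using prime_lift_two m by blast
  then interpret L: prime_lift 2 2 2 "multiplicity 2 (q + 1) + 1" h q c0 .
  have eq: "1 + int g * (2 * int t) = 1 + int g' * int 2 ^ 2 * int t" for t by (simp add: g'(1))
  have "2 ^ h dvd modulus (Suc 0)" unfolding special_modulus by (simp add: g'(1) h_def)
  then have "orbit_rel q (2 ^ h) (1 + int g' * int 2 ^ 2 * int c) (1 + int g' * int 2 ^ 2 * int c')"
    using rel unfolding special_node eq by (rule orbit_rel_dvd)
  moreover have "c < 2 ^ (min (multiplicity 2 (q + 1) + 1) h - 2)" "c' < 2 ^ (min (multiplicity 2 (q + 1) + 1) h - 2)"
    using c special_bound(1) False by (simp_all add: h_def)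
  moreover have "\<not> int 2 dvd int g'" "\<not> int 2 dvd 1" using g' by simp_all
  ultimately show ?thesis by (intro L.lift_unique[of "int g'" 1])
qed

end

sublocale orbit_tree q u modulus node "\<lambda>_. children"
proof
  fix x y :: "nat \<Rightarrow> nat" and k :: nat
  assume "\<forall>i\<in>{1..k}. x i = y i"
  then show "node x k = node y k"
    unfolding gamma_base_def by (intro arg_cong2[where f = "(+)"] arg_cong2[where f = "(*)"] sum.cong) auto
next
  fix x :: "nat \<Rightarrow> nat" and k :: nat
  show "[node x (Suc k) = node x k] (mod int (modulus k))" if "k < u"
  proof (cases "special (Suc k)")
    case True
    then show ?thesis by (simp add: node_Suc cofactor_def cong_iff_dvd_diff)
  next
    case False
    then show ?thesis by (simp only: node_Suc if_False) (simp add: cong_iff_dvd_diff flip: mult.assoc)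
  qed
  show "modulus k dvd modulus (Suc k)" by (simp add: cofactor_Suc)
next
  fix x :: "nat \<Rightarrow> nat" and k :: nat and w
  assume k: "k < u" and w: "orbit_rel q (modulus k) w (node x k)"
  show "\<exists>c\<in>children (Suc k). orbit_rel q (modulus (Suc k)) w (node (x(Suc k := c)) (Suc k))"
  proof (cases "special (Suc k)")
    case True
    then have "special 1" "k = 0" by auto
    then show ?thesis using special_exists k w by (simp add: cofactor_def gamma_base_def)
  next
    case False
    then show ?thesis using regular_exists[OF k] w by blast
  qed
next
  fix x :: "nat \<Rightarrow> nat" and k :: nat and c c'
  assume k: "k < u" and c: "c \<in> children (Suc k)" "c' \<in> children (Suc k)"
    and rel: "orbit_rel q (modulus (Suc k)) (node (x(Suc k := c)) (Suc k)) (node (x(Suc k := c')) (Suc k))"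
  show "c = c'"
  proof (cases "special (Suc k)")
    case True
    then have "special 1" "k = 0" by auto
    then show ?thesis using special_unique[of c c' x] k c rel by simp
  next
    case False
    then show ?thesis using regular_unique[OF k False c rel] by blast
  qed
qed simp

lemma base_exists:
  assumes "[w = 1] (mod int g)"
  shows "\<exists>x\<in>(\<Pi>\<^sub>E k\<in>{1..u}. children k). orbit_rel q (modulus u) w (node x u)"
proof -
  have "orbit_rel q (modulus 0) w (node undefined 0)"
    using assms by (intro orbit_rel_cong_refl) (simp add: cofactor_def gamma_base_def)
  then obtain x where x: "\<forall>i\<in>{1..u}. x i \<in> children i" "orbit_rel q (modulus u) w (node x u)"
    using node_exists[of w undefined u] by blast
  have "node (restrict x {1..u}) u = node x u" by (rule v_cong) simp
  then show ?thesis using x by (intro bexI[of _ "restrict x {1..u}"]) auto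
qed

lemma base_unique:
  assumes x: "x \<in> (\<Pi>\<^sub>E k\<in>{1..u}. children k)" and y: "y \<in> (\<Pi>\<^sub>E k\<in>{1..u}. children k)"
    and rel: "orbit_rel q (modulus u) (node x u) (node y u)"
  shows "x = y"
proof -
  have "\<forall>i\<in>{1..u}. x i = y i"
    using x y rel by (intro node_unique) (auto simp: PiE_def Pi_def)
  then show ?thesis using x y by (intro PiE_ext) auto
qed

end

theorem theorem7p2:
  fixes p e q g n n1 u s :: nat
    and gs es fs ps js :: "nat \<Rightarrow> nat"
    and S :: "nat \<Rightarrow> nat \<Rightarrow> int \<Rightarrow> nat set"
  assumes "prime p" and "1 \<le> e" and "q = p ^ e"
    and "0 < g" and "g dvd q - 1"
    and "0 < n" and "coprime n q"
    and "g = (\<Prod>k\<in>{1..u}. gs k ^ es k)"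
    and "n1 = (\<Prod>k\<in>{1..u}. gs k ^ fs k)"
    and "n = n1 * (\<Prod>k\<in>{1..s}. ps k ^ js k)"
    and "\<forall>k\<in>{1..u}. prime (gs k) \<and> gs k \<noteq> p"
    and "\<forall>k\<in>{1..s}. prime (ps k) \<and> ps k \<noteq> p"
    and "\<forall>k\<in>{1..u}. \<forall>l\<in>{1..s}. gs k \<noteq> ps l"
    and "strict_mono_on {1..u} gs" and "strict_mono_on {1..s} ps"
    and "\<forall>k\<in>{1..u}. 1 \<le> es k" and "\<forall>k\<in>{1..s}. 1 \<le> js k"
    and "representative_choice q S"
  defines "X \<equiv> \<Pi>\<^sub>E k\<in>{1..u}. {0..gs k ^ y_exp q gs es fs k - 1}"
    and "\<I> \<equiv> \<lambda>x. index_set q s ps js (n1 * g) (gamma_base q g u gs fs x)"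
    and "C \<equiv> \<lambda>x I. cyclotomic_coset q (n * g)
               (gamma_level q S ps js (n1 * g) (gamma_base q g u gs fs x) I s)"
  shows "{(1 + int k * int g) mod int (n * g) | k. k \<le> n - 1} = (\<Union>x\<in>X. \<Union>I\<in>\<I> x. C x I) \<and>
    disjoint_family_on (\<lambda>(x, I). C x I) (SIGMA x:X. \<I> x)"
proof -
  have q1: "1 < q" using assms(1-3) one_less_power[of p e] prime_gt_1_nat[of p] by simp
  interpret base: base_construction q g u gs es fs
    using q1 assms by unfold_locales auto
  have modulus_u: "g * base.cofactor u = n1 * g" using assms(9) by (simp add: base.cofactor_def)
  have N0: "0 < n1 * g" "coprime (n1 * g) q" using base.modulus_props[of u] modulus_u by simp_all
  have gen: "general_construction q s S ps js (n1 * g)"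
  proof
    fix k assume k: "k \<in> {1..s}"
    then have pk: "prime (ps k)" "ps k \<noteq> p" using assms(12) by blast+
    have "\<not> ps k dvd gs i ^ b" if "i \<in> {1..u}" for i b
      using that assms(11,13) k pk by (metis prime_dvd_power primes_dvd_imp_eq)
    then have "\<not> ps k dvd g" "\<not> ps k dvd n1"
      unfolding assms(8,9) using pk(1) by (auto simp: prime_dvd_prod_iff)
    moreover have "\<not> ps k dvd q"
      using assms(1,3) pk by (metis prime_dvd_power primes_dvd_imp_eq)
    ultimately show "prime (ps k) \<and> \<not> ps k dvd q \<and> \<not> ps k dvd n1 * g"
      using pk(1) by (simp add: prime_dvd_mult_iff)
  qed (use q1 N0 assms in auto)
  \<comment> \<open>The base point stays a parameter because it varies with
    \<open>x\<close>.\<close>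
  interpret G: general_construction q s S ps js "n1 * g" \<gamma> for \<gamma>
    by (rule gen)
  have modulus_s: "level_modulus ps js (n1 * g) (Suc s) = n * g"
    using assms(10) by (simp add: level_modulus_def atLeastLessThanSuc_atLeastAtMost)
  have M: "0 < n * g" "coprime q (n * g)"
    using assms(4,6,7) base.coprime_qg by (simp_all add: coprime_commute)
  have base_dvd: "n1 * g dvd n * g" using assms(10) by simp
  let ?v = "\<lambda>x I. gamma_level q S ps js (n1 * g) (gamma_base q g u gs fs x) I s"
  have C_iff: "z \<in> C x I \<longleftrightarrow> 0 \<le> z \<and> z < int (n * g) \<and> orbit_rel q (n * g) (?v x I) z" for x I z
    unfolding C_def cyclotomic_coset_eq[OF M] by blast
  have v_base: "[?v x I = gamma_base q g u gs fs x] (mod int (n1 * g))" for x I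
    using G.gamma_level_cong_base[of s] by simp
  have lhs: "{(1 + int k * int g) mod int (n * g) | k. k \<le> n - 1} =
      {z. 0 \<le> z \<and> z < int (n * g) \<and> [z = 1] (mod int g)}"
  proof (intro Set.equalityI subsetI)
    fix z assume "z \<in> {(1 + int k * int g) mod int (n * g) | k. k \<le> n - 1}"
    then obtain k where z: "z = (1 + int k * int g) mod int (n * g)" by blast
    have "[z = 1 + int k * int g] (mod int g)"
      unfolding z by (rule cong_dvd_modulus[of _ _ "int (n * g)"]) (simp_all add: cong_def)
    moreover have "[1 + int k * int g = 1] (mod int g)" by (simp add: cong_iff_dvd_diff)
    ultimately have "[z = 1] (mod int g)" by (rule cong_trans)
    then show "z \<in> {z. 0 \<le> z \<and> z < int (n * g) \<and> [z = 1] (mod int g)}"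
      using M(1) unfolding z by simp
  next
    fix z assume "z \<in> {z. 0 \<le> z \<and> z < int (n * g) \<and> [z = 1] (mod int g)}"
    then have z: "0 \<le> z" "z < int (n * g)" "int g dvd z - 1" by (auto simp: cong_iff_dvd_diff)
    then obtain c where c: "z - 1 = int g * c" by (auto elim: dvdE)
    define k where "k = nat (c mod int n)"
    have n0: "0 < int n" using assms(6) by simp
    have k: "int k = c mod int n" "k \<le> n - 1"
      using n0 pos_mod_bound[OF n0, of c] by (auto simp: k_def nat_le_iff)
    have "[int k = c] (mod int n)" by (simp add: k cong_def)
    then have "int n * int g dvd (int k - c) * int g"
      unfolding cong_iff_dvd_diff by (intro mult_dvd_mono) auto
    moreover have "(int k - c) * int g = (1 + int k * int g) - z" using c by (simp add: algebra_simps)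
    ultimately have "[1 + int k * int g = z] (mod int (n * g))" by (simp add: cong_iff_dvd_diff)
    then have "z = (1 + int k * int g) mod int (n * g)" using z by (simp add: cong_def)
    then show "z \<in> {(1 + int k * int g) mod int (n * g) | k. k \<le> n - 1}" using k(2) by blast
  qed
  have "{(1 + int k * int g) mod int (n * g) | k. k \<le> n - 1} = (\<Union>x\<in>X. \<Union>I\<in>\<I> x. C x I)"
    unfolding lhs
  proof (intro Set.equalityI subsetI)
    fix z assume "z \<in> {z. 0 \<le> z \<and> z < int (n * g) \<and> [z = 1] (mod int g)}"
    then have z: "0 \<le> z" "z < int (n * g)" "[z = 1] (mod int g)" by auto
    obtain x where x: "x \<in> X" "orbit_rel q (n1 * g) z (gamma_base q g u gs fs x)"
      using base.base_exists[OF z(3)] unfolding modulus_u X_def by blast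
    obtain I where I: "I \<in> \<I> x" "orbit_rel q (n * g) z (?v x I)"
      using G.index_exists[OF x(2)] unfolding modulus_s \<I>_def by blast
    then have "z \<in> C x I" using z C_iff orbit_rel_sym[OF M] by blast
    then show "z \<in> (\<Union>x\<in>X. \<Union>I\<in>\<I> x. C x I)" using x(1) I(1) by blast
  next
    fix z assume "z \<in> (\<Union>x\<in>X. \<Union>I\<in>\<I> x. C x I)"
    then obtain x I where "z \<in> C x I" by blast
    then obtain i where z: "0 \<le> z" "z < int (n * g)" and i: "[?v x I * int q ^ i = z] (mod int (n * g))"
      unfolding C_iff by (auto simp: orbit_rel_def)
    have "[?v x I = gamma_base q g u gs fs x] (mod int g)"
      using v_base by (rule cong_dvd_modulus) simp
    then have "[?v x I = 1] (mod int g)" using base.node_cong_1 cong_trans by blast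
    from cong_mult[OF this base.q_pow_cong_1, of i]
    have "[?v x I * int q ^ i = 1] (mod int g)" by simp
    moreover have "[?v x I * int q ^ i = z] (mod int g)" using i by (rule cong_dvd_modulus) simp
    ultimately have "[z = 1] (mod int g)" using cong_sym cong_trans by blast
    then show "z \<in> {z. 0 \<le> z \<and> z < int (n * g) \<and> [z = 1] (mod int g)}" using z by blast
  qed
  moreover have "disjoint_family_on (\<lambda>(x, I). C x I) (SIGMA x:X. \<I> x)"
  proof -
    have "x = x' \<and> I = I'"
      if "x \<in> X" "I \<in> \<I> x" "x' \<in> X" "I' \<in> \<I> x'" "z \<in> C x I" "z \<in> C x' I'" for x I x' I' z
    proof -
      have rel: "orbit_rel q (n * g) (?v x I) (?v x' I')"
        using that(5,6) orbit_rel_common[OF M] unfolding C_iff by blast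
      \<comment> \<open>Modulo \<open>n1 * g\<close> the index \<open>I\<close> is invisible, so
        \<open>x\<close> is determined first; only then do \<open>I\<close> and \<open>I'\<close>
        belong to the same index set.\<close>
      then have "orbit_rel q (n1 * g) (?v x I) (?v x' I')" using orbit_rel_dvd[OF base_dvd] by blast
      then have "orbit_rel q (n1 * g) (gamma_base q g u gs fs x) (gamma_base q g u gs fs x')"
        using orbit_rel_cong[OF v_base v_base] by blast
      then have "x = x'"
        using base.base_unique that(1,3) unfolding modulus_u X_def by blast
      then show ?thesis using G.index_unique[of I _ I'] that(2,4) rel unfolding modulus_s \<I>_def by blast
    qed
    then show ?thesis unfolding disjoint_family_on_def by fastforce
  qed
  ultimately show ?thesis ..
qed

end
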